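(* Let $\mu$ be the Patterson–Sullivan measure for $F$. Then \[ \mu \left( \left\{ \xi \in \Lambda F: \liminf_{t\to+\infty} d(\gamma(t), F x_0 ) > 3C\ \text{ for the arc-length parametrized ray } \gamma = [x_0, \xi) \right\} \right) = 0. \]
   Context: $\Gamma=\{\mathfrak{g}_1,\mathfrak{g}_2,\ldots\}$ (a fixed enumeration) is a non-elementary, non-convex-cocompact discrete group acting properly by isometries on $\mathbb{H}^d\ni x_0$ (non-elementary: limit set has more than two points; convex-cocompact: for some $K'>0$ all geodesics $[gx_0,hx_0]$, $g,h\in\Gamma$, lie in the $K'$-neighborhood of $\Gamma x_0$). $\|g\|:=d(x_0,gx_0)$; $B_r:=\{g\in\Gamma:\|g\|<r\}$; $(x|y)_z=\frac12[d(x,z)+d(z,y)-d(x,y)]$; $\mathcal{P}_A(s)=\sum_{g\in A}e^{-s\|g\|}$ with abscissa of convergence $\delta_A$. $\mathcal{O}_{M,M}$ is the set of $g\in\Gamma$ for which there are $x,y\in\mathbb{H}^d$ with $d(x,x_0),d(y,gx_0)\le M$ and $d([x,y],\Gamma x_0)\ge M$. Fixed $a,b\in\Gamma$ satisfy $\|a^n\|,\|b^n\|\to+\infty$ as $n\to+\infty$ and $\|a\|\ge10^3\|b\|>10^6(3+\sup_{n,m\in\mathbb{Z}}(a^nx_0|b^mx_0)_{x_0})$, the supremum being finite. Put $C:=10^{-3}\|a\|$. An element $h\in\Gamma$ has Property (A) if there are $n\ge1$ and points $x_0=z_0,\ldots,z_n=hx_0$ such that in the sequence $(a^{-1}x_0,z_0,\ldots,z_n,hax_0)$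 consecutive points are at distance $\ge\|a\|$ and any three consecutive points $u,v,w$ satisfy $(u|w)_v\le10^{-6}\|a\|$. $\Phi:\Gamma\to\{g: g\text{ has Property (A)}\}$ is a fixed map with $\Phi(g)=g$ if $g$ has Property (A); otherwise $\Phi(g)$ is one of $bg,gb,bgb$ having Property (A) if $\|g\|\ge\|a\|$ (one of them always does), and $\Phi(g)=bab$ if $\|g\|<\|a\|$. Construction of $F$. For $S\subseteq\Gamma$ let $\langle S\rangle_a:=\{g_1ag_2a\cdots ag_n:n\ge1,g_i\in S\}$. Fix $0<\epsilon<1$. Take $r_0$ with $\#B_r\le\exp((1+0.001\epsilon)\delta_\Gamma r)$ for $r\ge r_0$, and $R_0>\frac{10^7(C+r_0)(1+\delta_\Gamma)}{\delta_\Gamma\epsilon}$ with $\#(B_{R_0}\cap\Phi(\Gamma))\ge\exp((1-0.001\epsilon)\delta_\Gamma R_0)$. Let $K$ be a maximal subset of $(B_{R_0}\cap\Phi(\Gamma))\setminus B_{(1-0.003\epsilon)R_0}$ such that $d(gx_0,hx_0)>0.004\epsilon R_0$ for distinct $g,h\in K$. Let $F_1=\langle K\rangle_a$, $\alpha_1=\delta_{F_1}$, and pick $\beta_1\in(\alpha_1,\alpha_1+0.5)$ with $\mathcal{P}_{F_1}(\beta_1)>2$. Inductively, for $k\ge1$, given $\varphi_1,\ldots,\varphi_{k-1}$, $F_k=\langle K\cup\{\varphi_1,\ldots,\varphi_{k-1}\}\rangle_a$ and $\beta_1>\cdots>\beta_k$, put $M_j=\mathcal{P}_{F_k}(\beta_j)$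 and pick, for each $j\le k$, $\epsilon_j\in(0,1/2)$ with $2\epsilon_jM_j<1$ and $\frac{M_j+2\epsilon_j+4M_j\epsilon_j}{1-2\epsilon_jM_j}<(2-2^{j-k-1})\mathcal{P}_{F_j}(\beta_j)$; pick $R_k>100R_{k-1}$ with $K\cup\{\varphi_1,\ldots,\varphi_{k-1}\}\subseteq B_{R_k-10^4C}$ and $e^{-\beta_jR_k}\le\epsilon_j$ for all $j\le k$; pick $\phi_k\in\mathcal{O}_{10C,10C}\setminus B_{R_k+2500C}$; set $\varphi_k:=\Phi(\phi_k)\,a\,\Phi(\mathfrak{g}_k)$, $F_{k+1}:=\langle K\cup\{\varphi_1,\ldots,\varphi_k\}\rangle_a$, $\alpha_{k+1}:=\delta_{F_{k+1}}$, and pick $\beta_{k+1}\in(\alpha_{k+1},\min(\alpha_{k+1}+2^{-k-1},\beta_k))$ with $\mathcal{P}_{F_{k+1}}(\beta_{k+1})>2^{k+1}$. Finally $F:=\bigcup_kF_k=\langle K\cup\{\varphi_1,\varphi_2,\ldots\}\rangle_a$; one has $\mathcal{P}_F(\delta_F)=+\infty$. Patterson–Sullivan measure. For $s>\delta_F$ let $\mu_{x_0}^s=\frac{1}{\mathcal{P}_F(s)}\sum_{g\in F}e^{-s\|g\|}\mathrm{Dir}_{gx_0}$ ($\mathrm{Dir}$ = Dirac mass), a probability measure on the compact set $\Gamma x_0\cup\partial\mathbb{H}^d$. Choose $s_n\searrow\delta_F$ such that $\mu_{x_0}^{s_n}$ converges weakly; the limit $\mu$ is called the Patterson–Sullivan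 measure for $F$. $\Lambda F\subseteq\partial\mathbb{H}^d$ is the set of accumulation points of $Fx_0$ in $\partial\mathbb{H}^d$. *)

theory Defs
  imports "HOL-Analysis.Analysis" "HOL-Algebra.Group_Action"
begin

section \<open>Hyperbolic space\<close>

text \<open>
  Hyperbolic \<open>d\<close>-space is the Poincar\'e ball in a Euclidean space of dimension \<open>d\<close>, with curvature
  \<open>-1\<close>.  Its boundary at infinity is the unit sphere, and the topology of the compactification is
  the Euclidean topology of the closed unit ball.
\<close>

abbreviation hspace :: "'a::euclidean_space set" where
  "hspace \<equiv> ball 0 1"

abbreviation hboundary :: "'a::euclidean_space set" where
  "hboundary \<equiv> sphere 0 1"

definition hdist :: "'a::euclidean_space \<Rightarrow> 'a \<Rightarrow> real" where
  "hdist x y = arcosh (1 + 2 * (norm (x - y))\<^sup>2 / ((1 - (norm x)\<^sup>2) * (1 - (norm y)\<^sup>2)))"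

definition hsetdist :: "'a::euclidean_space set \<Rightarrow> 'a set \<Rightarrow> real" where
  "hsetdist A B = Inf {hdist x y | x y. x \<in> A \<and> y \<in> B}"

definition gromov_product :: "'a::euclidean_space \<Rightarrow> 'a \<Rightarrow> 'a \<Rightarrow> real" where
  "gromov_product x y z = (hdist x z + hdist z y - hdist x y) / 2"

definition geodesic_on :: "real set \<Rightarrow> (real \<Rightarrow> 'a::euclidean_space) \<Rightarrow> bool" where
  "geodesic_on T \<gamma> \<longleftrightarrow> \<gamma> ` T \<subseteq> hspace \<and> (\<forall>s\<in>T. \<forall>t\<in>T. hdist (\<gamma> s) (\<gamma> t) = \<bar>s - t\<bar>)"

text \<open>Geodesics between two given end points are unique, so the union below has one member.\<close>

definition hsegment :: "'a::euclidean_space \<Rightarrow> 'a \<Rightarrow> 'a set" where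
  "hsegment x y =
     \<Union> {\<gamma> ` {0..hdist x y} | \<gamma>.
          geodesic_on {0..hdist x y} \<gamma> \<and> \<gamma> 0 = x \<and> \<gamma> (hdist x y) = y}"

definition geodesic_ray :: "'a::euclidean_space \<Rightarrow> 'a \<Rightarrow> (real \<Rightarrow> 'a) \<Rightarrow> bool" where
  "geodesic_ray x \<xi> \<gamma> \<longleftrightarrow> geodesic_on {0..} \<gamma> \<and> \<gamma> 0 = x \<and> (\<gamma> \<longlongrightarrow> \<xi>) at_top"

section \<open>Weak convergence of measures on a subspace\<close>

text \<open>Testing against \<open>f = 1\<close> shows that a weak limit of probability measures is one.\<close>

definition weak_limit_on ::
    "'a::euclidean_space set \<Rightarrow> (nat \<Rightarrow> 'a measure) \<Rightarrow> 'a measure \<Rightarrow> bool" where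
  "weak_limit_on X \<mu>s \<mu> \<longleftrightarrow>
     sets \<mu> = sets (restrict_space borel X) \<and>
     (\<forall>f::'a \<Rightarrow> real. continuous_on X f \<and> bounded (f ` X) \<longrightarrow>
        (\<lambda>n. \<integral>x. f x \<partial>\<mu>s n) \<longlonglongrightarrow> (\<integral>x. f x \<partial>\<mu>))"

section \<open>Groups acting on hyperbolic space\<close>

text \<open>
  The group is abstract and the action need not be faithful.  The first locale only carries
  notation, so the definitions made in it hold unconditionally.
\<close>

locale hyp_data =
  fixes G :: "('g, 'm) monoid_scheme" (structure)
    and act :: "'g \<Rightarrow> 'a::euclidean_space \<Rightarrow> 'a"
    and x0 :: 'a
begin

definition gnorm :: "'g \<Rightarrow> real" where
  "gnorm g = hdist x0 (act g x0)"

definition gball :: "real \<Rightarrow> 'g set" where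
  "gball r = {g \<in> carrier G. gnorm g < r}"

definition orb :: "'g set \<Rightarrow> 'a set" where
  "orb A = (\<lambda>g. act g x0) ` A"

definition limit_set :: "'g set \<Rightarrow> 'a set" where
  "limit_set A = {\<xi> \<in> hboundary. \<xi> islimpt orb A}"

definition poincare :: "'g set \<Rightarrow> real \<Rightarrow> ennreal" where
  "poincare A s = (\<Sum>\<^sub>\<infinity>g\<in>A. ennreal (exp (- s * gnorm g)))"

text \<open>
  The abscissa of convergence as a real number; it is only used for infinite \<open>A\<close>, where the series
  diverges for \<open>s \<le> 0\<close>, and for sets whose series converges for some \<open>s\<close>.
\<close>

definition crit_exp :: "'g set \<Rightarrow> real" where
  "crit_exp A = Inf {s. poincare A s < \<infinity>}"

definition nonelementary :: bool where
  "nonelementary \<longleftrightarrow> \<not> (finite (limit_set (carrier G)) \<and> card (limit_set (carrier G)) \<le> 2)"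

definition convex_cocompact :: bool where
  "convex_cocompact \<longleftrightarrow>
     (\<exists>K'>0. \<forall>g\<in>carrier G. \<forall>h\<in>carrier G. \<forall>p\<in>hsegment (act g x0) (act h x0).
        \<exists>k\<in>carrier G. hdist p (act k x0) < K')"

definition O_set :: "real \<Rightarrow> 'g set" where
  "O_set M = {g \<in> carrier G. \<exists>x\<in>hspace. \<exists>y\<in>hspace.
     hdist x x0 \<le> M \<and> hdist y (act g x0) \<le> M \<and>
     hsetdist (hsegment x y) (orb (carrier G)) \<ge> M}"

text \<open>The sequence in Property (A) is \<open>ps\<close>, and \<open>zs\<close> lists \<open>z\<^sub>0, \<dots>, z\<^sub>n\<close>, whence \<open>n + 1 \<ge> 2\<close>.\<close>

definition property_A :: "'g \<Rightarrow> 'g \<Rightarrow> bool" where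
  "property_A a h \<longleftrightarrow>
     (\<exists>zs. length zs \<ge> 2 \<and> set zs \<subseteq> hspace \<and> hd zs = x0 \<and> last zs = act h x0 \<and>
        (let ps = [act (inv a) x0] @ zs @ [act (h \<otimes> a) x0] in
          (\<forall>i. i + 1 < length ps \<longrightarrow> hdist (ps ! i) (ps ! (i + 1)) \<ge> gnorm a) \<and>
          (\<forall>i. i + 2 < length ps \<longrightarrow>
             gromov_product (ps ! i) (ps ! (i + 2)) (ps ! (i + 1)) \<le> gnorm a / 10 ^ 6)))"

text \<open>\<open>a_words a S\<close> is the set of all \<open>g\<^sub>1 a g\<^sub>2 a \<dots> a g\<^sub>n\<close> with \<open>n \<ge> 1\<close> and \<open>g\<^sub>i \<in> S\<close>.\<close>

inductive_set a_words :: "'g \<Rightarrow> 'g set \<Rightarrow> 'g set" for a :: 'g and S :: "'g set" where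
  single: "g \<in> S \<Longrightarrow> g \<in> a_words a S"
| cons: "g \<in> S \<Longrightarrow> w \<in> a_words a S \<Longrightarrow> g \<otimes> a \<otimes> w \<in> a_words a S"

definition orbit_with_boundary :: "'a set" where
  "orbit_with_boundary = orb (carrier G) \<union> hboundary"

text \<open>
  The weighted sum of Dirac masses is obtained as the image, under \<open>g \<mapsto> g x\<^sub>0\<close>, of the measure on
  \<open>A\<close> giving \<open>g\<close> its weight; group elements with the same orbit point thus contribute separately.
\<close>

definition ps_approx :: "'g set \<Rightarrow> real \<Rightarrow> 'a measure" where
  "ps_approx A s =
     distr (density (count_space A) (\<lambda>g. ennreal (exp (- s * gnorm g)) / poincare A s))
       (restrict_space borel orbit_with_boundary) (\<lambda>g. act g x0)"

definition patterson_sullivan :: "'g set \<Rightarrow> 'a measure \<Rightarrow> bool" where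
  "patterson_sullivan A \<mu> \<longleftrightarrow>
     (\<exists>s::nat \<Rightarrow> real. decseq s \<and> (\<forall>n. s n > crit_exp A) \<and> s \<longlonglongrightarrow> crit_exp A \<and>
        weak_limit_on orbit_with_boundary (\<lambda>n. ps_approx A (s n)) \<mu>)"

end

locale hyp_action = hyp_data G act x0 + group_action G hspace act
  for G :: "('g, 'm) monoid_scheme" (structure)
    and act :: "'g \<Rightarrow> 'a::euclidean_space \<Rightarrow> 'a"
    and x0 :: 'a +
  assumes basepoint: "x0 \<in> hspace"
    and isometric: "g \<in> carrier G \<Longrightarrow> x \<in> hspace \<Longrightarrow> y \<in> hspace \<Longrightarrow>
          hdist (act g x) (act g y) = hdist x y"
    and proper: "compact Q \<Longrightarrow> Q \<subseteq> hspace \<Longrightarrow> finite {g \<in> carrier G. act g ` Q \<inter> Q \<noteq> {}}"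

section \<open>The construction of the set F\<close>

locale hyp_extension = hyp_action G act x0
  for G :: "('g, 'm) monoid_scheme" (structure)
    and act :: "'g \<Rightarrow> 'a::euclidean_space \<Rightarrow> 'a"
    and x0 :: 'a +
  fixes enum :: "nat \<Rightarrow> 'g" and a b :: 'g and \<Phi> :: "'g \<Rightarrow> 'g"
  assumes not_elementary: nonelementary
    and not_convex_cocompact: "\<not> convex_cocompact"
    and enumeration: "enum ` {1..} = carrier G"
    and a_b_in_G: "a \<in> carrier G" "b \<in> carrier G"
    and a_powers: "filterlim (\<lambda>n::nat. gnorm (a [^] n)) at_top sequentially"
    and b_powers: "filterlim (\<lambda>n::nat. gnorm (b [^] n)) at_top sequentially"
    and gromov_bounded:
      "bdd_above (range (\<lambda>(n::int, m::int). gromov_product (act (a [^] n) x0) (act (b [^] m) x0) x0))"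
    and a_b_norms:
      "gnorm a \<ge> 10 ^ 3 * gnorm b"
      "10 ^ 3 * gnorm b > 10 ^ 6 *
         (3 + (SUP (n::int, m::int). gromov_product (act (a [^] n) x0) (act (b [^] m) x0) x0))"
    and \<Phi>_range: "g \<in> carrier G \<Longrightarrow> \<Phi> g \<in> carrier G \<and> property_A a (\<Phi> g)"
    and \<Phi>_fix: "g \<in> carrier G \<Longrightarrow> property_A a g \<Longrightarrow> \<Phi> g = g"
    and \<Phi>_long: "g \<in> carrier G \<Longrightarrow> \<not> property_A a g \<Longrightarrow> gnorm g \<ge> gnorm a \<Longrightarrow>
          \<Phi> g \<in> {b \<otimes> g, g \<otimes> b, b \<otimes> g \<otimes> b}"
    and \<Phi>_short: "g \<in> carrier G \<Longrightarrow> \<not> property_A a g \<Longrightarrow> gnorm g < gnorm a \<Longrightarrow>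
          \<Phi> g = b \<otimes> a \<otimes> b"
begin

definition C :: real where
  "C = gnorm a / 10 ^ 3"

definition shell :: "real \<Rightarrow> real \<Rightarrow> 'g set" where
  "shell \<epsilon> r = (gball r \<inter> \<Phi> ` carrier G) - gball ((1 - 0.003 * \<epsilon>) * r)"

definition separated :: "real \<Rightarrow> 'g set \<Rightarrow> bool" where
  "separated \<rho> S \<longleftrightarrow> (\<forall>g\<in>S. \<forall>h\<in>S. g \<noteq> h \<longrightarrow> hdist (act g x0) (act h x0) > \<rho>)"

text \<open>\<open>F_stage K \<phi> k\<close> is \<open>F\<^sub>k\<close>, for \<open>k \<ge> 1\<close>; it depends only on \<open>K\<close> and \<open>\<phi>\<^sub>1, \<dots>, \<phi>\<^sub>k\<^sub>-\<^sub>1\<close>.\<close>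

definition F_stage :: "'g set \<Rightarrow> (nat \<Rightarrow> 'g) \<Rightarrow> nat \<Rightarrow> 'g set" where
  "F_stage K \<phi> k = a_words a (K \<union> \<phi> ` {1..<k})"

definition F_total :: "'g set \<Rightarrow> (nat \<Rightarrow> 'g) \<Rightarrow> 'g set" where
  "F_total K \<phi> = (\<Union>k\<in>{1..}. F_stage K \<phi> k)"

end

text \<open>
  All sequences start at index \<open>1\<close>, except \<open>R\<close>, which starts with \<open>R 0 = R\<^sub>0\<close>.  The number
  \<open>\<epsilon>\<^sub>j\<close> chosen in step \<open>k\<close> is \<open>eps k j\<close>, the element chosen in \<open>\<O>\<^bsub>10C,10C\<^esub>\<close> is \<open>\<phi>' k\<close>, and the new
  generator is \<open>\<phi> k\<close>.
\<close>

locale F_construction = hyp_extension G act x0 enum a b \<Phi>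
  for G :: "('g, 'm) monoid_scheme" (structure)
    and act :: "'g \<Rightarrow> 'a::euclidean_space \<Rightarrow> 'a"
    and x0 :: 'a
    and enum :: "nat \<Rightarrow> 'g" and a b :: 'g and \<Phi> :: "'g \<Rightarrow> 'g" +
  fixes \<epsilon> r0 :: real and R :: "nat \<Rightarrow> real" and K :: "'g set"
    and \<beta> :: "nat \<Rightarrow> real" and eps :: "nat \<Rightarrow> nat \<Rightarrow> real"
    and \<phi>' \<phi> :: "nat \<Rightarrow> 'g"
  assumes \<epsilon>_bounds: "0 < \<epsilon>" "\<epsilon> < 1"
    and r0_nonneg: "0 \<le> r0"
    and r0_growth: "r \<ge> r0 \<Longrightarrow>
          real (card (gball r)) \<le> exp ((1 + 0.001 * \<epsilon>) * crit_exp (carrier G) * r)"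
    \<comment> \<open>The lower bound for \<open>R\<^sub>0\<close> has denominator \<open>\<delta>\<^sub>\<Gamma> \<epsilon>\<close>; multiplied out, it does not depend on the
      value of division by zero.\<close>
    and R0_large: "R 0 * (crit_exp (carrier G) * \<epsilon>) > 10 ^ 7 * (C + r0) * (1 + crit_exp (carrier G))"
    and R0_growth: "real (card (gball (R 0) \<inter> \<Phi> ` carrier G)) \<ge>
          exp ((1 - 0.001 * \<epsilon>) * crit_exp (carrier G) * R 0)"
    and K_separated: "K \<subseteq> shell \<epsilon> (R 0)" "separated (0.004 * \<epsilon> * R 0) K"
    and K_maximal: "K \<subseteq> K' \<Longrightarrow> K' \<subseteq> shell \<epsilon> (R 0) \<Longrightarrow> separated (0.004 * \<epsilon> * R 0) K' \<Longrightarrow> K' = K"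
    and \<beta>_1: "crit_exp (F_stage K \<phi> 1) < \<beta> 1" "\<beta> 1 < crit_exp (F_stage K \<phi> 1) + 0.5"
      "poincare (F_stage K \<phi> 1) (\<beta> 1) > 2"
    and eps_bounds: "1 \<le> j \<Longrightarrow> j \<le> k \<Longrightarrow> 0 < eps k j \<and> eps k j < 1 / 2"
    and eps_small: "1 \<le> j \<Longrightarrow> j \<le> k \<Longrightarrow> M = enn2real (poincare (F_stage K \<phi> k) (\<beta> j)) \<Longrightarrow>
          2 * eps k j * M < 1 \<and>
          (M + 2 * eps k j + 4 * M * eps k j) / (1 - 2 * eps k j * M) <
            (2 - 2 powi (int j - int k - 1)) * enn2real (poincare (F_stage K \<phi> j) (\<beta> j))"
    and R_large: "1 \<le> k \<Longrightarrow> R k > 100 * R (k - 1)"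
    and R_contains: "1 \<le> k \<Longrightarrow> K \<union> \<phi> ` {1..<k} \<subseteq> gball (R k - 10 ^ 4 * C)"
    and R_decay: "1 \<le> j \<Longrightarrow> j \<le> k \<Longrightarrow> exp (- \<beta> j * R k) \<le> eps k j"
    and \<phi>'_choice: "1 \<le> k \<Longrightarrow> \<phi>' k \<in> O_set (10 * C) - gball (R k + 2500 * C)"
    and \<phi>_eq: "1 \<le> k \<Longrightarrow> \<phi> k = \<Phi> (\<phi>' k) \<otimes> a \<otimes> \<Phi> (enum k)"
    and \<beta>_Suc: "1 \<le> k \<Longrightarrow> crit_exp (F_stage K \<phi> (k + 1)) < \<beta> (k + 1)"
      "1 \<le> k \<Longrightarrow> \<beta> (k + 1) < min (crit_exp (F_stage K \<phi> (k + 1)) + 1 / 2 ^ (k + 1)) (\<beta> k)"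
      "1 \<le> k \<Longrightarrow> poincare (F_stage K \<phi> (k + 1)) (\<beta> (k + 1)) > 2 ^ (k + 1)"

end

theory Submission
  imports Defs
begin

text \<open>
  The sequence witnessing Property (A) for a word in \<open>F\<close> passes through the orbit points of all its
  prefixes, which again lie in \<open>F\<close>, and hyperbolicity makes it a quasi-geodesic: the geodesic from
  \<open>x\<^sub>0\<close> to the orbit point of a word passes close to the orbit points of its prefixes.  Suppose that
  the ray to \<open>\<xi>\<close> stays away from \<open>F x\<^sub>0\<close> after time \<open>m\<close>.  Then a word whose orbit point is close to
  \<open>\<xi>\<close> has no prefix of moderate length above \<open>m\<close>, so right after a prefix of length below \<open>m\<close> it
  contains a very long generator \<open>\<phi>\<^sub>k\<close>.  The words of this kind have, relative to the whole Poincare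
  series, weight at most a constant times \<open>\<Sum>\<^sub>k exp (- s \<parallel>\<phi>\<^sub>k\<parallel>)\<close> over large \<open>k\<close>.  These tails tend to \<open>0\<close>
  uniformly in \<open>s > \<delta>\<^sub>F\<close> because \<open>\<delta>\<^sub>F > 0\<close>, which follows from freeness of the words in two elements
  of \<open>K\<close>.  The estimate passes to the weak limit on open sets.
\<close>

section \<open>Hyperbolicity of the ball\<close>

text \<open>Being the end point of an avoiding ray is not an open condition, while upper bounds
  survive a weak limit on open sets. Hence the statement about words is proved on a whole
  neighbourhood of each end point, where closeness to \<xi> is expressed by a large Gromov product
  with the ray. Membership in \<open>null_sets\<close> also demands measurability; this is why the
  exceptional set is exhausted by closed sets with a fixed time m and a fixed threshold. The
  quantifiers come in the order m, then a constant c depending on m and on an upper bound for s,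
  then the index N of the late generators: c stays fixed while N grows. A positive lower bound for s
  turns the crude inequality \<open>gnorm (\<phi> k) \<ge> real k\<close> into geometric tails. All
  hyperbolic constants are explicit. Ptolemy's inequality gives the four-point condition with
  constant 5, and \<open>gnorm a > 3 * 10 ^ 6\<close>, so additive errors are absorbed by
  \<open>C = gnorm a / 10 ^ 3\<close>: tracking costs at most \<open>2 * gap + 10 \<le> C\<close>,
  below the distance \<open>3 * C\<close> kept by the ray.\<close>

lemma norm_diff_inversion:
  fixes x y :: "'a::real_inner"
  assumes "x \<noteq> 0" "y \<noteq> 0"
  shows "norm (x /\<^sub>R (norm x)\<^sup>2 - y /\<^sub>R (norm y)\<^sup>2) = norm (x - y) / (norm x * norm y)"
proof -
  have "(norm (x /\<^sub>R (norm x)\<^sup>2 - y /\<^sub>R (norm y)\<^sup>2))\<^sup>2 = (norm (x - y) / (norm x * norm y))\<^sup>2"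
    using assms
    unfolding power_divide power_mult_distrib
    unfolding power2_norm_eq_inner
    by (simp add: inner_diff_left inner_diff_right inner_commute field_simps)
  then show ?thesis
    by (metis abs_norm_cancel abs_mult abs_divide power2_eq_iff_nonneg norm_ge_zero divide_nonneg_nonneg mult_nonneg_nonneg)
qed

text \<open>Inversion centred at w turns the claim into the triangle inequality for the images of x,
  y and z, after multiplication by the three distances to w.\<close>

lemma ptolemy_inequality:
  fixes x y z w :: "'a::real_inner"
  shows "norm (x - y) * norm (z - w) \<le> norm (x - z) * norm (y - w) + norm (x - w) * norm (y - z)"
proof (cases "x = w \<or> y = w \<or> z = w")
  case True
  then show ?thesis
    by (auto simp: norm_minus_commute mult.commute)
next
  case False
  define i where "i v = v /\<^sub>R (norm v)\<^sup>2" for v :: 'a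
  have i: "norm (i (u - w) - i (v - w)) = norm (u - v) / (norm (u - w) * norm (v - w))"
    if "u \<noteq> w" "v \<noteq> w" for u v
    using norm_diff_inversion[of "u - w" "v - w"] that by (simp add: i_def)
  have "norm (i (x - w) - i (y - w)) \<le> norm (i (x - w) - i (z - w)) + norm (i (y - w) - i (z - w))"
    by (metis norm_diff_triangle_ineq norm_minus_commute norm_triangle_sub dist_norm dist_triangle2)
  then have "norm (x - y) / (norm (x - w) * norm (y - w)) \<le>
      norm (x - z) / (norm (x - w) * norm (z - w)) + norm (y - z) / (norm (y - w) * norm (z - w))"
    using False by (simp add: i)
  then show ?thesis
    using False by (simp add: field_simps)
qed

text \<open>With the square root of the conformal denominator, \<open>sinh\<close> and
  \<open>cosh\<close> of half the distance become a Euclidean quantity divided by a product of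
  weights, so homogeneous Euclidean inequalities transfer by division.\<close>

definition hweight :: "'a::euclidean_space \<Rightarrow> real" where
  "hweight x = sqrt (1 - (norm x)\<^sup>2)"

lemma hweight_pos: "x \<in> hspace \<Longrightarrow> hweight x > 0"
  and hweight_le_1: "hweight x \<le> 1"
  and hweight_squared: "x \<in> hspace \<Longrightarrow> (hweight x)\<^sup>2 = 1 - (norm x)\<^sup>2"
  by (auto simp: hweight_def abs_square_less_1 power_le_one abs_square_le_1)

lemma hdist_arg_ge_1:
  assumes "x \<in> hspace" "y \<in> hspace"
  shows "1 + 2 * (norm (x - y))\<^sup>2 / ((1 - (norm x)\<^sup>2) * (1 - (norm y)\<^sup>2)) \<ge> (1::real)"
  using assms hweight_squared[of x] hweight_squared[of y]
  by (metis le_add_same_cancel1 divide_nonneg_nonneg mult_nonneg_nonneg zero_le_numeral zero_le_power2)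

lemma hdist_nonneg: "x \<in> hspace \<Longrightarrow> y \<in> hspace \<Longrightarrow> hdist x y \<ge> 0"
  unfolding hdist_def by (rule arcosh_nonneg_real[OF hdist_arg_ge_1])

lemma hdist_commute: "hdist x y = hdist y x"
  by (simp add: hdist_def norm_minus_commute mult.commute)

lemma hdist_self [simp]: "hdist x x = 0"
  by (simp add: hdist_def)

lemma sinh_half_hdist:
  assumes "x \<in> hspace" "y \<in> hspace"
  shows "sinh (hdist x y / 2) = norm (x - y) / (hweight x * hweight y)"
proof -
  have "cosh (hdist x y) = 1 + 2 * (sinh (hdist x y / 2))\<^sup>2"
    using cosh_double_cosh[of "hdist x y / 2"] by (simp add: cosh_square_eq)
  moreover have "cosh (hdist x y) = 1 + 2 * (norm (x - y) / (hweight x * hweight y))\<^sup>2"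
    using assms cosh_arcosh_real[OF hdist_arg_ge_1[OF assms]]
    by (simp add: hdist_def power_divide power_mult_distrib hweight_squared)
  ultimately have "(sinh (hdist x y / 2))\<^sup>2 = (norm (x - y) / (hweight x * hweight y))\<^sup>2"
    by simp
  moreover have "sinh (hdist x y / 2) \<ge> 0"
    using hdist_nonneg[OF assms] by simp
  moreover have "norm (x - y) / (hweight x * hweight y) \<ge> 0"
    using hweight_pos[OF assms(1)] hweight_pos[OF assms(2)] by simp
  ultimately show ?thesis
    by (metis power2_eq_iff_nonneg)
qed

text \<open>The inversion \<open>y / |y|\<^sup>2\<close> of \<open>y\<close> has distance \<open>hconj x y / |y|\<close> from \<open>x\<close>.\<close>

definition hconj :: "'a::euclidean_space \<Rightarrow> 'a \<Rightarrow> real" where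
  "hconj x y = sqrt (1 - 2 * (x \<bullet> y) + (norm x)\<^sup>2 * (norm y)\<^sup>2)"

lemma hconj_commute: "hconj x y = hconj y x"
  by (simp add: hconj_def inner_commute mult.commute)

lemma hconj_arg_ge: "1 - 2 * (x \<bullet> y) + (norm x)\<^sup>2 * (norm y)\<^sup>2 \<ge> (1 - norm x * norm y)\<^sup>2"
  for x y :: "'a::euclidean_space"
proof -
  have "x \<bullet> y \<le> norm x * norm y"
    by (rule norm_cauchy_schwarz)
  then show ?thesis
    by (simp add: power2_diff power_mult_distrib)
qed

lemma hconj_inversion: "y \<noteq> 0 \<Longrightarrow> norm (x - y /\<^sub>R (norm y)\<^sup>2) * norm y = hconj x y"
proof -
  assume "y \<noteq> 0"
  then have "(norm (x - y /\<^sub>R (norm y)\<^sup>2) * norm y)\<^sup>2 = 1 - 2 * (x \<bullet> y) + (norm x)\<^sup>2 * (norm y)\<^sup>2"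
    unfolding power_mult_distrib unfolding power2_norm_eq_inner
    by (simp add: inner_diff_left inner_diff_right inner_commute field_simps)
  then show ?thesis
    by (metis hconj_def norm_ge_zero mult_nonneg_nonneg real_sqrt_unique)
qed

lemma cosh_half_hdist:
  assumes "x \<in> hspace" "y \<in> hspace"
  shows "cosh (hdist x y / 2) = hconj x y / (hweight x * hweight y)"
proof -
  have pos: "hweight x > 0" "hweight y > 0"
    using assms by (auto intro: hweight_pos)
  have "(cosh (hdist x y / 2))\<^sup>2 = 1 + (norm (x - y) / (hweight x * hweight y))\<^sup>2"
    by (simp add: cosh_square_eq sinh_half_hdist[OF assms])
  also have "\<dots> = ((hweight x)\<^sup>2 * (hweight y)\<^sup>2 + (norm (x - y))\<^sup>2) / (hweight x * hweight y)\<^sup>2"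
    using pos by (simp add: field_simps power_mult_distrib)
  also have "(hweight x)\<^sup>2 * (hweight y)\<^sup>2 + (norm (x - y))\<^sup>2 = (hconj x y)\<^sup>2"
  proof -
    have "(hconj x y)\<^sup>2 = 1 - 2 * (x \<bullet> y) + (norm x)\<^sup>2 * (norm y)\<^sup>2"
      unfolding hconj_def using order_trans[OF zero_le_power2 hconj_arg_ge[of x y]] by simp
    then show ?thesis
      using assms by (simp only: hweight_squared) (simp add: power2_norm_eq_inner algebra_simps inner_commute)
  qed
  finally have "(cosh (hdist x y / 2))\<^sup>2 = (hconj x y / (hweight x * hweight y))\<^sup>2"
    by (simp add: power_divide)
  moreover have "hconj x y / (hweight x * hweight y) \<ge> 0"
    unfolding hconj_def using pos order_trans[OF zero_le_power2 hconj_arg_ge[of x y]] by simp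
  ultimately show ?thesis
    by (metis power2_eq_iff_nonneg cosh_real_nonneg)
qed

text \<open>By the addition formula for \<open>sinh\<close> at half distances the claim is a
  Euclidean inequality, namely Ptolemy's for x, z, y and the inversion of y in the unit sphere. The
  centre has no inversion and is treated apart.\<close>

lemma hdist_triangle:
  assumes "x \<in> hspace" "y \<in> hspace" "z \<in> hspace"
  shows "hdist x z \<le> hdist x y + hdist y z"
proof -
  have pos: "hweight x > 0" "hweight y > 0" "hweight z > 0"
    using assms by (auto intro: hweight_pos)
  have *: "norm (x - z) * (hweight y)\<^sup>2 \<le> norm (x - y) * hconj y z + hconj x y * norm (y - z)"
  proof (cases "y = 0")
    case True
    then show ?thesis
      using norm_triangle_ineq4[of x z] by (simp add: hweight_def hconj_def)
  next
    case False
    define y' where "y' = y /\<^sub>R (norm y)\<^sup>2"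
    have "norm (y - y') * norm y = 1 - (norm y)\<^sup>2"
    proof -
      have "y' - y = (1 / (norm y)\<^sup>2 - 1) *\<^sub>R y"
        by (simp add: y'_def algebra_simps divide_inverse)
      moreover have "(norm y)\<^sup>2 < 1"
        using assms(2) by (simp add: abs_square_less_1)
      then have "1 / (norm y)\<^sup>2 - 1 \<ge> 0"
        using False by simp
      ultimately have "norm (y' - y) = (1 / (norm y)\<^sup>2 - 1) * norm y"
        by simp
      then have "norm (y - y') * norm y = (1 / (norm y)\<^sup>2 - 1) * (norm y)\<^sup>2"
        by (simp add: norm_minus_commute power2_eq_square)
      then show ?thesis
        using False by (simp add: left_diff_distrib)
    qed
    moreover have "norm (x - z) * norm (y - y') \<le> norm (x - y) * norm (z - y') + norm (x - y') * norm (z - y)"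
      by (rule ptolemy_inequality)
    from mult_right_mono[OF this norm_ge_zero[of y]] have "norm (x - z) * (norm (y - y') * norm y) \<le>
        norm (x - y) * (norm (z - y') * norm y) + (norm (x - y') * norm y) * norm (z - y)"
      by (simp only: distrib_left distrib_right ac_simps)
    ultimately show ?thesis
      using hconj_inversion[OF False, of x] hconj_inversion[OF False, of z] assms(2)
      by (simp add: y'_def hweight_squared hconj_commute norm_minus_commute)
  qed
  have "sinh (hdist x z / 2) \<le> sinh (hdist x y / 2 + hdist y z / 2)"
    unfolding sinh_add using assms pos *
    by (simp add: sinh_half_hdist cosh_half_hdist field_simps power2_eq_square)
  then show ?thesis
    by simp
qed

lemma hdist_ptolemy:
  assumes "x \<in> hspace" "y \<in> hspace" "z \<in> hspace" "w \<in> hspace"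
  shows "sinh (hdist x y / 2) * sinh (hdist z w / 2) \<le>
    sinh (hdist x z / 2) * sinh (hdist y w / 2) + sinh (hdist x w / 2) * sinh (hdist y z / 2)"
proof -
  have pos: "hweight x > 0" "hweight y > 0" "hweight z > 0" "hweight w > 0"
    using assms by (auto intro: hweight_pos)
  have "norm (x - y) * norm (z - w) \<le> norm (x - z) * norm (y - w) + norm (x - w) * norm (y - z)"
    by (rule ptolemy_inequality)
  then have "norm (x - y) * norm (z - w) / (hweight x * hweight y * hweight z * hweight w) \<le>
    (norm (x - z) * norm (y - w) + norm (x - w) * norm (y - z)) / (hweight x * hweight y * hweight z * hweight w)"
    using pos by (intro divide_right_mono) auto
  then show ?thesis
    using assms by (simp add: sinh_half_hdist add_divide_distrib ac_simps)
qed

lemma exp_sinh_bounds: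
  fixes t :: real
  assumes "t \<ge> 0"
  shows "sinh t \<le> exp t / 2" "exp t \<le> 2 * sinh t + 1"
  using assms by (auto simp: sinh_field_def field_simps)

text \<open>Ptolemy's inequality for \<open>sinh (hdist x y / 2)\<close> is a four-point condition
  once \<open>sinh\<close> is replaced by the exponential. This costs 16 on the left and 1/4 on the
  right, and a sum of two terms is at most twice their maximum: altogether a factor 8 \<le> exp
  (5/2), whence the constant 5. If a side on the left has length at most 2, the triangle inequality
  gives the claim with error 4.\<close>

lemma hdist_four_point:
  assumes "x \<in> hspace" "y \<in> hspace" "z \<in> hspace" "w \<in> hspace"
  shows "hdist x y + hdist z w \<le> max (hdist x z + hdist y w) (hdist x w + hdist y z) + 5"
proof -
  define m where "m = max (hdist x z + hdist y w) (hdist x w + hdist y z)"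
  show ?thesis
  proof (cases "hdist x y \<le> 2 \<or> hdist z w \<le> 2")
    case True
    then show ?thesis
      using hdist_triangle[of z x w] hdist_triangle[of x y w] hdist_triangle[of x z y]
        hdist_triangle[of z w y] assms hdist_commute[of z x] hdist_commute[of z y] hdist_commute[of w y]
      by auto
  next
    case False
    have *: "exp t \<le> 4 * sinh t" if "t \<ge> 1" for t :: real
      using exp_sinh_bounds(2)[of t] exp_ge_add_one_self[of t] that by linarith
    have "exp ((hdist x y + hdist z w) / 2) = exp (hdist x y / 2) * exp (hdist z w / 2)"
      by (simp add: exp_add[symmetric] add_divide_distrib)
    also have "\<dots> \<le> (4 * sinh (hdist x y / 2)) * (4 * sinh (hdist z w / 2))"
      using False by (intro mult_mono *) auto
    also have "\<dots> \<le> 16 * (sinh (hdist x z / 2) * sinh (hdist y w / 2) + sinh (hdist x w / 2) * sinh (hdist y z / 2))"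
      using hdist_ptolemy[OF assms] by simp
    also have "\<dots> \<le> 16 * ((exp (hdist x z / 2) / 2) * (exp (hdist y w / 2) / 2)
        + (exp (hdist x w / 2) / 2) * (exp (hdist y z / 2) / 2))"
      using assms by (intro mult_left_mono add_mono mult_mono exp_sinh_bounds) (auto intro: hdist_nonneg)
    also have "\<dots> = 4 * exp ((hdist x z + hdist y w) / 2) + 4 * exp ((hdist x w + hdist y z) / 2)"
      by (simp add: exp_add[symmetric] add_divide_distrib)
    also have "\<dots> \<le> 4 * exp (m / 2) + 4 * exp (m / 2)"
      by (intro add_mono mult_left_mono) (simp_all add: m_def max_def)
    also have "\<dots> = 8 * exp (m / 2)" by simp
    also have "8 \<le> exp (5 / 2 :: real)"
    proof -
      \<comment> \<open>\<open>1 + 5/8\<close> is the quadratic Taylor polynomial of exp at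
        1/2.\<close>
      have "(8::real) \<le> (1 + 5/8 ) ^ 5" by (simp add: power_divide eval_nat_numeral)
      also have "(1 + 5/8 :: real) ^ 5 \<le> exp (1/2) ^ 5"
        using exp_lower_Taylor_quadratic[of "1/2::real"] by (intro power_mono) (auto simp: power2_eq_square)
      also have "\<dots> = exp (5/2)"
        by (simp add: exp_of_nat_mult[symmetric])
      finally show ?thesis .
    qed
    then have "8 * exp (m / 2) \<le> exp (5/2) * exp (m / 2)" by simp
    also have "\<dots> = exp ((m + 5) / 2)" by (simp add: exp_add[symmetric] add_divide_distrib add.commute)
    finally show ?thesis by (simp add: m_def)
  qed
qed

section \<open>Gromov products and chains with small products\<close>

lemma gromov_product_commute: "gromov_product x y z = gromov_product y x z"
  by (simp add: gromov_product_def hdist_commute)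

lemma gromov_product_hyperbolic:
  assumes "x \<in> hspace" "y \<in> hspace" "z \<in> hspace" "w \<in> hspace"
  shows "gromov_product x z w \<ge> min (gromov_product x y w) (gromov_product y z w) - 5 / 2"
  using hdist_four_point[of x z y w] assms hdist_commute[of w z] hdist_commute[of w y] hdist_commute[of z y]
  unfolding gromov_product_def min_def max_def by (auto simp: field_simps split: if_splits)

lemma gromov_product_nonneg:
  "x \<in> hspace \<Longrightarrow> y \<in> hspace \<Longrightarrow> z \<in> hspace \<Longrightarrow> gromov_product x y z \<ge> 0"
  using hdist_triangle[of x z y] by (simp add: gromov_product_def)

text \<open>This converts a small product at one end of a long side into a large product at the
  other end, the form in which the hyperbolic inequality can be used.\<close>

lemma gromov_product_base_change: "gromov_product x z y = hdist x y - gromov_product y z x"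
  by (simp add: gromov_product_def field_simps hdist_commute)

text \<open>A sequence with long steps and small Gromov products is a local quasi-geodesic; by
  hyperbolicity a Gromov product based at a point of the sequence stays small when its arguments
  move away along the sequence.\<close>

lemma quasi_chain_forward:
  fixes z :: "nat \<Rightarrow> 'a::euclidean_space"
  assumes "\<And>i. i \<le> n \<Longrightarrow> z i \<in> hspace"
    and "\<And>i. i < n \<Longrightarrow> hdist (z i) (z (i + 1)) \<ge> L"
    and "\<And>i. i + 2 \<le> n \<Longrightarrow> gromov_product (z i) (z (i + 2)) (z (i + 1)) \<le> \<eta>"
    and "L > 2 * \<eta> + 5" "i < k" "k < n"
  shows "gromov_product (z i) (z (k + 1)) (z k) \<le> \<eta> + 5 / 2"
  using \<open>i < k\<close> \<open>k < n\<close>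
proof (induction k)
  case (Suc k)
  show ?case
  proof (cases "i = k")
    case True
    then show ?thesis using assms(3)[of k] Suc.prems by simp
  next
    case False
    then have "gromov_product (z i) (z (k + 1)) (z k) \<le> \<eta> + 5 / 2"
      using Suc by simp
    \<comment> \<open>This product exceeds \<eta> + 5/2 because L > 2 \<eta> + 5. In the hyperbolic
      inequality below the minimum is at most \<eta> + 5/2, so it is the other product, the one in
      the goal.\<close>
    then have "gromov_product (z k) (z i) (z (k + 1)) \<ge> L - (\<eta> + 5 / 2)"
      using assms(2)[of k] Suc.prems gromov_product_base_change[of "z k" "z i" "z (k + 1)"]
        gromov_product_commute[of "z i" "z (k + 1)" "z k"] by simp
    moreover have "gromov_product (z k) (z (k + 2)) (z (k + 1)) \<le> \<eta>"
      using assms(3)[of k] Suc.prems by simp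
    ultimately show ?thesis
      using gromov_product_hyperbolic[of "z k" "z i" "z (k + 2)" "z (k + 1)"] assms(1)[of k] assms(1)[of i]
        assms(1)[of "k + 1"] assms(1)[of "k + 2"] Suc.prems assms(4) by simp
  qed
qed simp

text \<open>The forward bound is used at \<open>z j\<close> and, for the reversed chain, at
  \<open>z (j + 1)\<close>. Base change moves the second bound to \<open>z j\<close>, where
  hyperbolicity joins the two at the cost of another 5/2.\<close>

lemma quasi_chain_middle:
  fixes z :: "nat \<Rightarrow> 'a::euclidean_space"
  assumes hz: "\<And>i. i \<le> n \<Longrightarrow> z i \<in> hspace"
    and L: "\<And>i. i < n \<Longrightarrow> hdist (z i) (z (i + 1)) \<ge> L"
    and gp: "\<And>i. i + 2 \<le> n \<Longrightarrow> gromov_product (z i) (z (i + 2)) (z (i + 1)) \<le> \<eta>"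
    and "L > 2 * \<eta> + 15 / 2" "i < j" "j < k" "k \<le> n"
  shows "gromov_product (z i) (z k) (z j) \<le> \<eta> + 5"
proof -
  have fwd: "gromov_product (z i) (z (j + 1)) (z j) \<le> \<eta> + 5 / 2"
    using assms by (intro quasi_chain_forward[where n = n and L = L]) auto
  show ?thesis
  proof (cases "j + 1 = k")
    case True
    then show ?thesis using fwd by simp
  next
    case False
    define z' where "z' l = z (k - l)" for l
    have "gromov_product (z' 0) (z' (k - j - 1 + 1)) (z' (k - j - 1)) \<le> \<eta> + 5 / 2"
    proof (rule quasi_chain_forward[where n = k and L = L])
      fix l assume "l < k"
      then show "L \<le> hdist (z' l) (z' (l + 1))"
        using L[of "k - l - 1"] \<open>k \<le> n\<close> by (simp add: z'_def hdist_commute Suc_diff_Suc)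
    next
      fix l assume "l + 2 \<le> k"
      then show "gromov_product (z' l) (z' (l + 2)) (z' (l + 1)) \<le> \<eta>"
        using gp[of "k - l - 2"] \<open>k \<le> n\<close>
        by (simp add: z'_def gromov_product_commute Suc_diff_Suc numeral_2_eq_2)
    qed (use assms False in \<open>auto simp: z'_def\<close>)
    then have "gromov_product (z k) (z j) (z (j + 1)) \<le> \<eta> + 5 / 2"
      using assms by (simp add: z'_def)
    then have "gromov_product (z (j + 1)) (z k) (z j) \<ge> L - (\<eta> + 5 / 2)"
      using L[of j] \<open>j < k\<close> \<open>k \<le> n\<close> gromov_product_base_change[of "z j" "z k" "z (j + 1)"]
        gromov_product_commute[of "z k" "z j" "z (j + 1)"] by simp
    moreover have "gromov_product (z i) (z (j + 1)) (z j) \<ge>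
        min (gromov_product (z i) (z k) (z j)) (gromov_product (z k) (z (j + 1)) (z j)) - 5 / 2"
      using assms by (intro gromov_product_hyperbolic) auto
    ultimately show ?thesis
      using fwd \<open>L > 2 * \<eta> + 15 / 2\<close> by (simp add: gromov_product_commute)
  qed
qed

section \<open>Geodesic rays and the boundary\<close>

lemma hdist_eq_0_imp_eq: "x \<in> hspace \<Longrightarrow> y \<in> hspace \<Longrightarrow> hdist x y = 0 \<Longrightarrow> x = y"
  using sinh_half_hdist[of x y] hweight_pos[of x] hweight_pos[of y] by simp

lemma continuous_on_hdist:
  assumes "continuous_on S f" "continuous_on S g" "f ` S \<subseteq> hspace" "g ` S \<subseteq> hspace"
  shows "continuous_on S (\<lambda>s. hdist (f s) (g s))"
proof -
  have pos: "(1 - (norm (f s))\<^sup>2) * (1 - (norm (g s))\<^sup>2) \<noteq> 0" if "s \<in> S" for s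
  proof -
    have "f s \<in> hspace" "g s \<in> hspace"
      using that assms(3,4) by auto
    then show ?thesis
      using hweight_pos[of "f s"] hweight_pos[of "g s"] hweight_squared[of "f s"] hweight_squared[of "g s"]
      by (metis mult_eq_0_iff zero_less_power less_irrefl)
  qed
  have "continuous_on S (\<lambda>s. 1 + 2 * (norm (f s - g s))\<^sup>2 / ((1 - (norm (f s))\<^sup>2) * (1 - (norm (g s))\<^sup>2)))"
    by (intro continuous_intros assms) (use pos in auto)
  then show ?thesis
    unfolding hdist_def
    by (rule continuous_on_compose2[OF continuous_on_arcosh[OF order.refl]]) (use assms(3,4) in \<open>auto simp del: mem_ball_0 intro!: hdist_arg_ge_1\<close>)
qed

text \<open>The formula for \<open>cosh\<close> of half the distance and 1 - norm x \<le>
  \<open>hconj x p\<close> \<le> 2 show, here and in the next lemma, that \<open>hweight p\<close>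
  is comparable to \<open>exp (- hdist x p / 2)\<close> with constants depending on x alone. This
  links closeness to the sphere with distance from the base point.\<close>

lemma hweight_lower_bound:
  assumes "x \<in> hspace" "p \<in> hspace"
  shows "(1 - norm x) * exp (- hdist x p / 2) \<le> hweight p"
proof -
  have pos: "hweight x > 0" "hweight p > 0"
    using assms by (auto intro: hweight_pos)
  have xp: "norm x * norm p \<le> norm x"
    using assms by (simp add: mult_left_le)
  have "(1 - norm x) / hweight p \<le> hconj x p / hweight p"
  proof (intro divide_right_mono)
    have "1 - norm x \<le> 1 - norm x * norm p"
      using xp by simp
    also have "\<dots> \<le> hconj x p"
      unfolding hconj_def by (intro real_le_rsqrt hconj_arg_ge)
    finally show "1 - norm x \<le> hconj x p" .
  qed (use pos in auto)
  also have "\<dots> \<le> hconj x p / (hweight x * hweight p)"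
  proof (intro divide_left_mono)
    show "hconj x p \<ge> 0"
      unfolding hconj_def using order_trans[OF zero_le_power2 hconj_arg_ge[of x p]] by simp
  qed (use pos hweight_le_1[of x] in \<open>auto simp: mult_le_cancel_right1\<close>)
  also have "\<dots> = cosh (hdist x p / 2)"
    by (rule cosh_half_hdist[OF assms, symmetric])
  also have "\<dots> \<le> exp (hdist x p / 2)"
    using hdist_nonneg[OF assms] by (simp add: cosh_field_def field_simps)
  finally show ?thesis
    using pos by (simp add: field_simps exp_minus)
qed

lemma hweight_upper_bound:
  assumes "x \<in> hspace" "p \<in> hspace"
  shows "hweight p \<le> 4 / hweight x * exp (- hdist x p / 2)"
proof -
  have pos: "hweight x > 0" "hweight p > 0"
    using assms by (auto intro: hweight_pos)
  have "hconj x p \<le> 2"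
  proof -
    have "norm x * norm p \<le> 1"
      using assms by (simp add: mult_le_one)
    moreover have "\<bar>x \<bullet> p\<bar> \<le> norm x * norm p"
      by (rule Cauchy_Schwarz_ineq2)
    ultimately have "1 - 2 * (x \<bullet> p) + (norm x)\<^sup>2 * (norm p)\<^sup>2 \<le> 4"
      using power_le_one[of "norm x * norm p" 2] by (simp add: power_mult_distrib)
    then have "sqrt (1 - 2 * (x \<bullet> p) + (norm x)\<^sup>2 * (norm p)\<^sup>2) \<le> sqrt 4"
      by (rule real_sqrt_le_mono)
    then show ?thesis
      by (simp add: hconj_def)
  qed
  have "exp (hdist x p / 2) \<le> 2 * cosh (hdist x p / 2)"
    by (simp add: cosh_field_def)
  also have "\<dots> \<le> 2 * (2 / (hweight x * hweight p))"
    unfolding cosh_half_hdist[OF assms] using pos \<open>hconj x p \<le> 2\<close>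
    by (intro mult_left_mono divide_right_mono) auto
  finally show ?thesis
    using pos by (simp add: field_simps exp_minus)
qed

text \<open>The left side is \<open>exp (hdist p q / 2)\<close> times a decaying factor for each of
  p and q. The weights bounding these factors cancel the denominators of
  \<open>sinh_half_hdist\<close>, and a Euclidean distance remains.\<close>

lemma exp_neg_gromov_product_le:
  assumes "x \<in> hspace" "p \<in> hspace" "q \<in> hspace"
  shows "exp (- gromov_product p q x) \<le> (2 * norm (p - q) + hweight p * hweight q) / (1 - norm x)\<^sup>2"
proof -
  have pos: "hweight p > 0" "hweight q > 0" "1 - norm x > 0"
    using assms by (auto intro: hweight_pos)
  have "exp (- gromov_product p q x) = exp (hdist p q / 2) * (exp (- hdist x p / 2) * exp (- hdist x q / 2))"
    by (simp add: gromov_product_def exp_add[symmetric] hdist_commute field_simps)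
  also have "\<dots> \<le> (2 * sinh (hdist p q / 2) + 1) * (hweight p / (1 - norm x) * (hweight q / (1 - norm x)))"
    using hweight_lower_bound[OF assms(1,2)] hweight_lower_bound[OF assms(1,3)] pos
      hdist_nonneg[OF assms(2,3)]
    by (intro mult_mono exp_sinh_bounds) (auto simp: field_simps)
  also have "\<dots> = (2 * norm (p - q) + hweight p * hweight q) / (1 - norm x)\<^sup>2"
  proof -
    have "(2 * (n / (u * v)) + 1) * (u / w * (v / w)) = (2 * n + u * v) / w\<^sup>2"
      if "u > 0" "v > 0" "w > 0" for n u v w :: real
      using that by (simp add: field_simps power2_eq_square)
    then show ?thesis
      unfolding sinh_half_hdist[OF assms(2,3)] using pos by blast
  qed
  finally show ?thesis .
qed

lemma gromov_product_large_near_boundary: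
  fixes \<xi> x :: "'a::euclidean_space"
  assumes "\<xi> \<in> hboundary" "x \<in> hspace"
  obtains r where "r > 0"
    "\<And>p q. p \<in> hspace \<Longrightarrow> q \<in> hspace \<Longrightarrow> dist \<xi> p < r \<Longrightarrow> dist \<xi> q < r \<Longrightarrow> gromov_product p q x \<ge> T"
proof
  \<comment> \<open>The 6 is 4 + 2: twice \<open>norm (p - q)\<close> is at most 4 r, and the
    product of the two weights is at most 2 r.\<close>
  define r where "r = exp (- T) * (1 - norm x)\<^sup>2 / 6"
  have x: "1 - norm x > 0"
    using assms by simp
  show "r > 0"
    using x by (simp add: r_def)
  fix p q assume pq: "p \<in> hspace" "q \<in> hspace" "dist \<xi> p < r" "dist \<xi> q < r"
  have w: "(hweight u)\<^sup>2 \<le> 2 * r" if "u \<in> hspace" "dist \<xi> u < r" for u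
  proof -
    have "1 - norm u < r"
      using that assms norm_triangle_ineq2[of \<xi> u] by (simp add: dist_norm)
    moreover have "1 - (norm u)\<^sup>2 = (1 - norm u) * (1 + norm u)"
      by (simp add: power2_eq_square algebra_simps)
    moreover have "(1 - norm u) * (1 + norm u) \<le> (1 - norm u) * 2"
      using that by (intro mult_left_mono) auto
    moreover have "(1 - norm u) * 2 \<le> 2 * r"
      using \<open>1 - norm u < r\<close> by simp
    ultimately show ?thesis
      unfolding hweight_squared[OF that(1)] by (metis order_trans)
  qed
  have "norm (p - q) \<le> 2 * r"
    using pq(3,4) dist_triangle3[of p q \<xi>] by (simp add: dist_norm)
  moreover have "hweight p * hweight q \<le> 2 * r"
    using w[OF pq(1,3)] w[OF pq(2,4)] sum_squares_bound[of "hweight p" "hweight q"] by linarith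
  ultimately have "(2 * norm (p - q) + hweight p * hweight q) / (1 - norm x)\<^sup>2 \<le> 6 * r / (1 - norm x)\<^sup>2"
    by (intro divide_right_mono) auto
  also have "\<dots> = exp (- T)"
    using x by (simp add: r_def)
  finally have "exp (- gromov_product p q x) \<le> exp (- T)"
    using exp_neg_gromov_product_le[OF assms(2) pq(1,2)] by linarith
  then show "gromov_product p q x \<ge> T"
    by simp
qed

definition ray_rate :: "'a::euclidean_space \<Rightarrow> real" where
  "ray_rate x = (4 / hweight x)\<^sup>2"

text \<open>Between times t and u the growth of \<open>sinh ((u - t) / 2)\<close> and the decay of
  both weights multiply to exp (- t), whatever u is; then u tends to infinity. The constant consists
  of two factors from \<open>hweight_upper_bound\<close> and is the same for all rays from
  x.\<close>

lemma geodesic_ray_rate: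
  assumes "geodesic_ray x \<xi> \<gamma>" "t \<ge> 0"
  shows "norm (\<gamma> t - \<xi>) \<le> ray_rate x * exp (- t)"
proof -
  have \<gamma>: "\<gamma> s \<in> hspace" "hdist x (\<gamma> s) = s" "s \<ge> 0 \<Longrightarrow> u \<ge> s \<Longrightarrow> hdist (\<gamma> s) (\<gamma> u) = u - s"
    if "s \<ge> 0" for s u
    using assms that by (auto simp: geodesic_ray_def geodesic_on_def)
  have x: "x \<in> hspace"
    using \<gamma>(1)[of 0] assms(1) by (simp add: geodesic_ray_def)
  have *: "norm (\<gamma> t - \<gamma> u) \<le> ray_rate x * exp (- t)" if "u \<ge> t" for u
  proof -
    have u: "u \<ge> 0" using that assms by simp
    have pos: "hweight (\<gamma> t) > 0" "hweight (\<gamma> u) > 0" "hweight x > 0"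
      using \<gamma>(1) assms(2) u x by (auto intro: hweight_pos)
    have "norm (\<gamma> t - \<gamma> u) = sinh ((u - t) / 2) * (hweight (\<gamma> t) * hweight (\<gamma> u))"
      using sinh_half_hdist[of "\<gamma> t" "\<gamma> u"] \<gamma>(1)[of t] \<gamma>(1)[of u] \<gamma>(3)[of t u] assms(2) that pos
      by (simp add: field_simps)
    also have "\<dots> \<le> exp ((u - t) / 2) * ((4 / hweight x * exp (- t / 2)) * (4 / hweight x * exp (- u / 2)))"
      using hweight_upper_bound[OF x \<gamma>(1)[of t]] hweight_upper_bound[OF x \<gamma>(1)[of u]] \<gamma>(2)[of t] \<gamma>(2)[of u]
        that assms(2) pos exp_sinh_bounds(1)[of "(u - t) / 2"]
        exp_gt_zero[of "(u - t) / 2"]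
      by (intro mult_mono) (auto simp del: exp_gt_zero)
    also have "\<dots> = ray_rate x * (exp ((u - t) / 2) * exp (- t / 2) * exp (- u / 2))"
      by (simp add: ray_rate_def power2_eq_square)
    also have "exp ((u - t) / 2) * exp (- t / 2) * exp (- u / 2) = exp (- t)"
      by (simp add: exp_add[symmetric] field_simps)
    finally show ?thesis .
  qed
  have "((\<lambda>u. norm (\<gamma> t - \<gamma> u)) \<longlongrightarrow> norm (\<gamma> t - \<xi>)) at_top"
    using assms(1) by (auto simp: geodesic_ray_def intro!: tendsto_intros)
  then show ?thesis
    by (rule tendsto_upperbound) (auto intro!: eventually_at_top_linorderI[of t] *)
qed

section \<open>Compactness and the closed sets of avoiding rays\<close>

lemma compact_hyperbolic_cball:
  assumes "x \<in> hspace"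
  shows "compact {y \<in> hspace. hdist x y \<le> r}"
proof -
  define c where "c = (1 - norm x) * exp (- r / 2)"
  have "c > 0"
    using assms by (simp add: c_def)
  have bound: "norm y \<le> sqrt (1 - c\<^sup>2)" if "y \<in> hspace" "hdist x y \<le> r" for y
  proof -
    have "c \<le> (1 - norm x) * exp (- hdist x y / 2)"
      unfolding c_def using that assms by (intro mult_left_mono) auto
    then have "c \<le> hweight y"
      using hweight_lower_bound[OF assms that(1)] by linarith
    then have "c\<^sup>2 \<le> 1 - (norm y)\<^sup>2"
      using power_mono[of c "hweight y" 2] \<open>c > 0\<close> by (simp add: hweight_squared[OF that(1)])
    then show ?thesis
      by (intro real_le_rsqrt) simp
  qed
  let ?B = "cball 0 (sqrt (1 - c\<^sup>2)) :: 'a set"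
  have "sqrt (1 - c\<^sup>2) < 1"
    using \<open>c > 0\<close> by simp
  then have B: "?B \<subseteq> hspace"
    by (metis ball_subset_cball cball_subset_ball_iff dist_self add_0 norm_zero)
  have "closedin (top_of_set ?B) (?B \<inter> hdist x -` {..r})"
    using B assms by (intro continuous_closedin_preimage continuous_on_hdist) (auto intro: continuous_intros)
  moreover have "?B \<inter> hdist x -` {..r} = {y \<in> hspace. hdist x y \<le> r}"
    using bound B by auto
  ultimately show ?thesis
    using closedin_compact[OF compact_cball] by metis
qed

text \<open>Fixing the time m and using a weak inequality makes each of these sets closed; the
  liminf condition becomes a countable union of them over m and thresholds q above the given
  one.\<close>

definition avoiding_rays :: "'a::euclidean_space \<Rightarrow> 'a set \<Rightarrow> real \<Rightarrow> real \<Rightarrow> 'a set" where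
  "avoiding_rays x A m q =
     {\<xi> \<in> hboundary. \<exists>\<gamma>. geodesic_ray x \<xi> \<gamma> \<and> (\<forall>t\<ge>m. \<forall>p\<in>A. hdist (\<gamma> t) p \<ge> q)}"

text \<open>By Tychonoff, the pairs (ray, end point) form a compact set for pointwise convergence:
  the uniform rate of convergence to the end point is a closed condition.\<close>

lemma closed_avoiding_rays:
  fixes x :: "'a::euclidean_space"
  assumes x: "x \<in> hspace" and A: "A \<subseteq> hspace" and m: "m \<ge> 0"
  shows "closed (avoiding_rays x A m q)"
proof -
  \<comment> \<open>For negative times this is the singleton of x, so the product may run over all
    reals and a ray is extended backwards by its starting point.\<close>
  define B where "B t = {y \<in> hspace. hdist x y \<le> max t 0}" for t
  define P where "P = Pi\<^sub>E UNIV B \<times> (hboundary :: 'a set)"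
  have "compact (Pi\<^sub>E UNIV B)"
    using compactin_PiE[of "\<lambda>_. euclidean" UNIV B] compact_hyperbolic_cball[OF x]
    by (simp add: B_def euclidean_product_topology)
  then have "compact P"
    unfolding P_def by (intro compact_Times) auto
  have eval: "continuous_on P (\<lambda>z. fst z t)" for t
    by (rule continuous_on_compose2[OF continuous_on_product_coordinates continuous_on_fst[OF continuous_on_id]]) auto
  have P_hspace: "(\<lambda>z. fst z t) ` P \<subseteq> hspace" for t
    by (auto simp: P_def B_def)
  define Z1 where "Z1 = (\<Inter>(s, t)\<in>{0..} \<times> {0..}. P \<inter> (\<lambda>z. hdist (fst z s) (fst z t)) -` {\<bar>s - t\<bar>})"
  define Z2 where "Z2 = (\<Inter>t\<in>{0..}. P \<inter> (\<lambda>z. norm (fst z t - snd z)) -` {..ray_rate x * exp (- t)})"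
  define Z3 where "Z3 = (\<Inter>(t, p)\<in>{m..} \<times> A. P \<inter> (\<lambda>z. hdist (fst z t) p) -` {q..})"
  have "closedin (top_of_set P) (P \<inter> (\<lambda>z. hdist (fst z s) (fst z t)) -` {\<bar>s - t\<bar>})" for s t
    by (intro continuous_closedin_preimage continuous_on_hdist eval P_hspace closed_singleton)
  then have Z1: "closedin (top_of_set P) Z1"
    unfolding Z1_def by (intro closedin_INT) auto
  have "closedin (top_of_set P) (P \<inter> (\<lambda>z. norm (fst z t - snd z)) -` {..ray_rate x * exp (- t)})" for t
    by (intro continuous_closedin_preimage continuous_intros eval closed_atMost)
  then have Z2: "closedin (top_of_set P) Z2"
    unfolding Z2_def by (intro closedin_INT) auto
  have "closedin (top_of_set P) (P \<inter> (\<lambda>z. hdist (fst z t) p) -` {q..})" if "p \<in> A" for t p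
    using that A
    by (intro continuous_closedin_preimage continuous_on_hdist eval P_hspace closed_atLeast) auto
  \<comment> \<open>For empty A the intersection defining \<open>Z3\<close> is the whole type rather
    than P, whence the case distinction.\<close>
  then have Z3: "closedin (top_of_set P) Z3" if "A \<noteq> {}"
    unfolding Z3_def using that by (intro closedin_INT) auto
  have "closedin (top_of_set P) (Z1 \<inter> Z2 \<inter> Z3)"
  proof (cases "A = {}")
    case True
    then show ?thesis
      using closedin_Int[OF Z1 Z2] by (simp add: Z3_def)
  qed (use Z1 Z2 Z3 in \<open>auto intro: closedin_Int\<close>)
  then have "compact (Z1 \<inter> Z2 \<inter> Z3)"
    using closedin_compact[OF \<open>compact P\<close>] by metis
  then have "compact (snd ` (Z1 \<inter> Z2 \<inter> Z3))"
    by (intro compact_continuous_image continuous_on_snd continuous_on_id)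
  moreover have "snd ` (Z1 \<inter> Z2 \<inter> Z3) = avoiding_rays x A m q"
  proof (intro equalityI subsetI)
    fix \<xi> assume "\<xi> \<in> snd ` (Z1 \<inter> Z2 \<inter> Z3)"
    then obtain \<gamma> where z: "(\<gamma>, \<xi>) \<in> Z1" "(\<gamma>, \<xi>) \<in> Z2" "(\<gamma>, \<xi>) \<in> Z3"
      by auto
    then have P: "(\<gamma>, \<xi>) \<in> P"
      by (auto simp: Z2_def)
    have "\<gamma> 0 = x"
    proof -
      have "\<gamma> 0 \<in> hspace" "hdist x (\<gamma> 0) \<le> 0"
        using P by (auto simp: P_def B_def PiE_def Pi_def dest!: spec[of _ 0])
      then show ?thesis
        using hdist_eq_0_imp_eq[OF x, of "\<gamma> 0"] hdist_nonneg[OF x, of "\<gamma> 0"] by simp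
    qed
    moreover have "geodesic_on {0..} \<gamma>"
      using z(1) P by (auto simp: geodesic_on_def Z1_def P_def B_def)
    moreover have "(\<gamma> \<longlongrightarrow> \<xi>) at_top"
    proof -
      have "((\<lambda>t. exp (- t :: real)) \<longlongrightarrow> 0) at_top"
        by (intro filterlim_compose[OF exp_at_bot] filterlim_uminus_at_bot_at_top)
      then have "((\<lambda>t. ray_rate x * exp (- t)) \<longlongrightarrow> 0) at_top"
        using tendsto_mult_left by fastforce
      then have "((\<lambda>t. \<gamma> t - \<xi>) \<longlongrightarrow> 0) at_top"
        by (rule Lim_null_comparison[rotated])
          (use z(2) in \<open>auto simp: Z2_def intro!: eventually_at_top_linorderI[of 0]\<close>)
      then show ?thesis
        by (simp add: LIM_zero_iff)
    qed
    ultimately show "\<xi> \<in> avoiding_rays x A m q"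
      using z(3) P by (auto simp: avoiding_rays_def geodesic_ray_def Z3_def P_def)
  next
    fix \<xi> assume "\<xi> \<in> avoiding_rays x A m q"
    then obtain \<gamma> where \<xi>: "\<xi> \<in> hboundary" and ray: "geodesic_ray x \<xi> \<gamma>"
      and avoid: "\<And>t p. t \<ge> m \<Longrightarrow> p \<in> A \<Longrightarrow> hdist (\<gamma> t) p \<ge> q"
      by (auto simp: avoiding_rays_def)
    define \<gamma>' where "\<gamma>' t = \<gamma> (max t 0)" for t
    have \<gamma>: "\<gamma> 0 = x" "\<And>t. t \<ge> 0 \<Longrightarrow> \<gamma> t \<in> hspace"
      "\<And>s t. s \<ge> 0 \<Longrightarrow> t \<ge> 0 \<Longrightarrow> hdist (\<gamma> s) (\<gamma> t) = \<bar>s - t\<bar>"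
      using ray by (auto simp: geodesic_ray_def geodesic_on_def)
    have "hdist x (\<gamma> t) = t" if "t \<ge> 0" for t
      using \<gamma>(1) \<gamma>(3)[of 0 t] that by simp
    then have P: "(\<gamma>', \<xi>) \<in> P"
      using \<gamma> \<xi> by (auto simp: P_def B_def \<gamma>'_def)
    moreover have "(\<gamma>', \<xi>) \<in> Z1" "(\<gamma>', \<xi>) \<in> Z2" "(\<gamma>', \<xi>) \<in> Z3"
      using P \<gamma>(3) geodesic_ray_rate[OF ray] avoid m
      by (auto simp: Z1_def Z2_def Z3_def \<gamma>'_def)
    ultimately show "\<xi> \<in> snd ` (Z1 \<inter> Z2 \<inter> Z3)"
      by (force intro: image_eqI[of _ _ "(\<gamma>', \<xi>)"])
  qed
  ultimately show ?thesis
    by (simp add: compact_imp_closed)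
qed

section \<open>Weak limits and counting measures\<close>

text \<open>This is the open-set half of the portmanteau theorem. Continuous functions
  \<open>f j\<close> below the indicator of U carry the bound to the limit, and the sets
  \<open>S j\<close> on which they equal 1 exhaust the part of U in X.\<close>

lemma weak_limit_on_open_le:
  fixes \<mu>s :: "nat \<Rightarrow> 'a::euclidean_space measure"
  assumes lim: "weak_limit_on X \<mu>s \<mu>" and "open U"
    and \<mu>s: "\<And>n. sets (\<mu>s n) = sets (restrict_space borel X)" "\<And>n. emeasure (\<mu>s n) X = 1"
    and le: "\<And>n. emeasure (\<mu>s n) (U \<inter> X) \<le> ennreal c" and "c \<ge> 0"
  shows "emeasure \<mu> (U \<inter> X) \<le> ennreal c"
proof -
  have sp: "space (\<mu>s n) = X" for n
    using sets_eq_imp_space_eq[OF \<mu>s(1)] by (simp add: space_restrict_space)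
  have sets_\<mu>: "sets \<mu> = sets (restrict_space borel X)"
    using lim by (simp add: weak_limit_on_def)
  have sp\<mu>: "space \<mu> = X"
    using sets_eq_imp_space_eq[OF sets_\<mu>] by (simp add: space_restrict_space)
  have conv: "(\<lambda>n. \<integral>x. f x \<partial>\<mu>s n) \<longlonglongrightarrow> (\<integral>x. f x \<partial>\<mu>)"
    if "continuous_on X f" "bounded (f ` X)" for f :: "'a \<Rightarrow> real"
    using lim that by (auto simp: weak_limit_on_def)
  have fin_s: "finite_measure (\<mu>s n)" for n
    by (rule finite_measureI) (simp add: sp \<mu>s(2))
  have "(\<lambda>n. \<integral>x. 1 \<partial>\<mu>s n) \<longlonglongrightarrow> (\<integral>x. (1::real) \<partial>\<mu>)"
    by (intro conv) (auto simp: bounded_iff)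
  then have "(\<lambda>n. 1) \<longlonglongrightarrow> measure \<mu> X"
    by (simp add: sp sp\<mu> measure_def \<mu>s(2))
  then have "measure \<mu> X = 1"
    using LIMSEQ_unique tendsto_const by metis
  \<comment> \<open>\<open>measure\<close> is 0 where \<open>emeasure\<close> is infinite, so the
    value 1 forces finiteness.\<close>
  then have fin: "finite_measure \<mu>"
    by (intro finite_measureI) (auto simp: sp\<mu> measure_def)
  have meas: "f \<in> borel_measurable N" if "continuous_on UNIV f" "sets N = sets (restrict_space borel X)"
    for f :: "'a \<Rightarrow> real" and N
    using measurable_restrict_space1[OF borel_measurable_continuous_onI[OF that(1)], of X]
      measurable_cong_sets[OF that(2) refl] by blast
  \<comment> \<open>The distance to the empty set is 0 by convention, hence the separate value when
    U is the whole space.\<close>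
  define h where "h x = (if U = UNIV then 1 else infdist x (- U))" for x
  have cont_h: "continuous_on UNIV h"
    by (cases "U = UNIV") (auto simp: h_def intro!: continuous_intros)
  have h_nonneg: "h x \<ge> 0" for x
    by (auto simp: h_def infdist_nonneg)
  have h_pos: "h x > 0 \<longleftrightarrow> x \<in> U" for x
  proof (cases "U = UNIV")
    case False
    then have "x \<in> - U \<longleftrightarrow> infdist x (- U) = 0"
      using \<open>open U\<close> by (intro in_closed_iff_infdist_zero) auto
    then show ?thesis
      using False h_nonneg[of x] by (auto simp: h_def)
  qed (auto simp: h_def)
  define f where "f j x = min 1 (real (Suc j) * h x)" for j x
  have cont_f: "continuous_on UNIV (f j)" for j
    unfolding f_def by (intro continuous_intros cont_h)
  have f01: "0 \<le> f j x" "f j x \<le> 1" for j x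
    using h_nonneg[of x] by (auto simp: f_def)
  have int_f: "integrable N (f j)" if "finite_measure N" "sets N = sets (restrict_space borel X)" for j N
    using that f01 by (intro finite_measure.integrable_const_bound[where B = 1] meas cont_f) auto
  have UX: "U \<inter> X \<in> sets (restrict_space borel X)"
    using \<open>open U\<close> by (auto simp: sets_restrict_space)
  have int_le: "(\<integral>x. f j x \<partial>\<mu>s n) \<le> c" for j n
  proof -
    have "(\<integral>x. f j x \<partial>\<mu>s n) \<le> (\<integral>x. indicator (U \<inter> X) x \<partial>\<mu>s n)"
    proof (rule integral_mono)
      show "integrable (\<mu>s n) (indicator (U \<inter> X) :: 'a \<Rightarrow> real)"
        using UX \<mu>s finite_measure.emeasure_finite[OF fin_s[of n], of "U \<inter> X"]
        by (simp add: less_top)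
      fix x assume "x \<in> space (\<mu>s n)"
      then show "f j x \<le> indicator (U \<inter> X) x"
        using f01(2)[of j x] h_pos[of x] h_nonneg[of x] by (auto simp: sp f_def indicator_def)
    qed (intro int_f fin_s \<mu>s(1))
    also have "\<dots> = measure (\<mu>s n) (U \<inter> X)"
      by (simp add: sp)
    also have "\<dots> \<le> c"
      unfolding measure_def using le[of n] \<open>c \<ge> 0\<close> by (intro enn2real_leI)
    finally show ?thesis .
  qed
  have int_le\<mu>: "(\<integral>x. f j x \<partial>\<mu>) \<le> c" for j
  proof (rule LIMSEQ_le_const2[OF conv])
    show "continuous_on X (f j)"
      using cont_f continuous_on_subset by blast
    show "bounded (f j ` X)"
      using f01 by (auto simp: bounded_iff intro!: exI[of _ 1])
  qed (use int_le in auto)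
  define S where "S j = {x \<in> X. 1 \<le> real (Suc j) * h x}" for j
  have S_sets: "S j \<in> sets \<mu>" for j
  proof -
    have "{x \<in> space \<mu>. 1 \<le> real (Suc j) * h x} \<in> sets \<mu>"
      using meas[OF cont_h sets_\<mu>] by measurable
    then show ?thesis
      by (simp add: S_def sp\<mu>)
  qed
  have "emeasure \<mu> (S j) \<le> ennreal c" for j
  proof -
    have "measure \<mu> (S j) = (\<integral>x. indicator (S j) x \<partial>\<mu>)"
      using S_sets[of j] sets.sets_into_space[OF S_sets[of j]] by (simp add: Int_absorb2)
    also have "\<dots> \<le> (\<integral>x. f j x \<partial>\<mu>)"
    proof (rule integral_mono)
      show "integrable \<mu> (indicator (S j) :: 'a \<Rightarrow> real)"
        using S_sets[of j] finite_measure.emeasure_finite[OF fin, of "S j"] by (simp add: less_top)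
      fix x
      show "indicator (S j) x \<le> f j x"
        using f01[of j x] by (auto simp: S_def f_def indicator_def)
    qed (intro int_f fin sets_\<mu>)
    also have "\<dots> \<le> c"
      by (rule int_le\<mu>)
    finally show ?thesis
      using finite_measure.emeasure_eq_measure[OF fin] by (simp add: ennreal_leI)
  qed
  moreover have "(SUP j. emeasure \<mu> (S j)) = emeasure \<mu> (\<Union>j. S j)"
  proof (rule SUP_emeasure_incseq)
    show "incseq S"
      unfolding incseq_Suc_iff S_def using h_nonneg
      by (auto intro: order_trans[OF _ mult_right_mono])
  qed (use S_sets in auto)
  moreover have "(\<Union>j. S j) = U \<inter> X"
  proof -
    have "(\<exists>j. 1 \<le> real (Suc j) * h x) \<longleftrightarrow> x \<in> U" for x
    proof
      assume "\<exists>j. 1 \<le> real (Suc j) * h x"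
      then show "x \<in> U"
        using h_pos[of x] h_nonneg[of x] by (cases "h x = 0") auto
    next
      assume "x \<in> U"
      then have "h x > 0"
        by (simp add: h_pos)
      then obtain j where "inverse (real (Suc j)) < h x"
        using reals_Archimedean by blast
      then show "\<exists>j. 1 \<le> real (Suc j) * h x"
        by (intro exI[of _ j]) (simp add: field_simps)
    qed
    then show ?thesis
      by (auto simp: S_def)
  qed
  ultimately show ?thesis
    by (metis SUP_least)
qed

text \<open>Through this identity the Poincare series, defined as an unordered sum, can be treated
  as the mass of a measure.\<close>

lemma infsum_ennreal_eq_nn_integral:
  fixes f :: "'b \<Rightarrow> ennreal"
  assumes "countable A"
  shows "infsum f A = (\<integral>\<^sup>+x. f x \<partial>count_space A)"
proof -
  have eq: "infsum f A = (SUP F\<in>{F. finite F \<and> F \<subseteq> A}. sum f F)"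
    by (intro nonneg_infsum_complete) auto
  have fin: "sum f F = (\<integral>\<^sup>+x. f x * indicator F x \<partial>count_space A)" if "finite F" "F \<subseteq> A" for F
    using that
    by (subst nn_integral_count_space'[where A = F]) (auto intro!: sum.cong simp: indicator_def)
  show ?thesis
  proof (rule antisym)
    show "infsum f A \<le> (\<integral>\<^sup>+x. f x \<partial>count_space A)"
      unfolding eq
      by (intro SUP_least) (auto simp: fin intro!: nn_integral_mono simp: indicator_def)
    show "(\<integral>\<^sup>+x. f x \<partial>count_space A) \<le> infsum f A"
    proof (cases "finite A")
      case True
      then show ?thesis
        by (simp add: nn_integral_count_space_finite)
    next
      case False
      define e where "e = from_nat_into A"
      have e: "bij_betw e UNIV A"
        unfolding e_def using assms False by (rule bij_betw_from_nat_into)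
      have "(\<integral>\<^sup>+x. f x \<partial>count_space A) = (\<Sum>i. f (e i))"
        by (simp add: nn_integral_bij_count_space[OF e, symmetric] nn_integral_count_space_nat)
      also have "\<dots> = (SUP n. \<Sum>i<n. f (e i))"
        by (rule suminf_eq_SUP)
      also have "\<dots> \<le> infsum f A"
        unfolding eq
      proof (intro SUP_mono bexI)
        fix n
        show "(\<Sum>i<n. f (e i)) \<le> sum f (e ` {..<n})"
          using inj_on_subset[OF bij_betw_imp_inj_on[OF e]] by (subst sum.reindex) auto
        show "e ` {..<n} \<in> {F. finite F \<and> F \<subseteq> A}"
          using bij_betw_imp_surj_on[OF e] by auto
      qed
      finally show ?thesis .
    qed
  qed
qed

section \<open>Property (A)\<close>

declare mem_ball [simp del] mem_ball_0 [simp del]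

context hyp_action
begin

sublocale G: group G
  using group_hom group_hom.axioms(1) by blast

lemma act_hspace [simp, intro]: "g \<in> carrier G \<Longrightarrow> x \<in> hspace \<Longrightarrow> act g x \<in> hspace"
  using element_image by blast

lemma orbit_hspace [intro]: "g \<in> carrier G \<Longrightarrow> act g x0 \<in> hspace"
  using act_hspace basepoint by blast

lemma act_mult: "g \<in> carrier G \<Longrightarrow> h \<in> carrier G \<Longrightarrow> x \<in> hspace \<Longrightarrow> act (g \<otimes> h) x = act g (act h x)"
  using composition_rule by blast

lemma act_one: "x \<in> hspace \<Longrightarrow> act \<one> x = x"
  using id_eq_one by (metis restrict_apply)

lemma gnorm_nonneg: "g \<in> carrier G \<Longrightarrow> gnorm g \<ge> 0"
  unfolding gnorm_def by (intro hdist_nonneg basepoint orbit_hspace)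

lemma hdist_act_mult:
  "g \<in> carrier G \<Longrightarrow> h \<in> carrier G \<Longrightarrow> hdist (act g x0) (act (g \<otimes> h) x0) = gnorm h"
  using basepoint by (simp only: act_mult gnorm_def) (intro isometric orbit_hspace, auto)

lemma hdist_orbit:
  assumes "g \<in> carrier G" "h \<in> carrier G"
  shows "hdist (act g x0) (act h x0) = gnorm (inv g \<otimes> h)"
proof -
  have "g \<otimes> (inv g \<otimes> h) = h"
    using assms by (simp add: G.m_assoc[symmetric])
  then show ?thesis
    using hdist_act_mult[of g "inv g \<otimes> h"] assms by simp
qed

lemma gnorm_mult_le: "g \<in> carrier G \<Longrightarrow> h \<in> carrier G \<Longrightarrow> gnorm (g \<otimes> h) \<le> gnorm g + gnorm h"
  using hdist_triangle[of x0 "act g x0" "act (g \<otimes> h) x0"] hdist_act_mult[of g h] basepoint orbit_hspace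
  by (simp add: gnorm_def)

lemma gnorm_one: "gnorm \<one> = 0"
  using act_one[OF basepoint] by (simp add: gnorm_def)

lemma gnorm_inv: "g \<in> carrier G \<Longrightarrow> gnorm (inv g) = gnorm g"
  using hdist_orbit[of g \<one>] act_one[OF basepoint] by (simp add: gnorm_def hdist_commute)

lemma gnorm_mult_ge_left:
  assumes "g \<in> carrier G" "h \<in> carrier G"
  shows "gnorm (g \<otimes> h) \<ge> gnorm h - gnorm g"
proof -
  have "inv g \<otimes> (g \<otimes> h) = h"
    using assms by (simp add: G.m_assoc[symmetric])
  then show ?thesis
    using gnorm_mult_le[of "inv g" "g \<otimes> h"] gnorm_inv[of g] assms by simp
qed

lemma gnorm_mult_ge_right:
  assumes "g \<in> carrier G" "h \<in> carrier G"
  shows "gnorm (g \<otimes> h) \<ge> gnorm g - gnorm h"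
proof -
  have "(g \<otimes> h) \<otimes> inv h = g"
    using assms by (simp add: G.m_assoc)
  then show ?thesis
    using gnorm_mult_le[of "g \<otimes> h" "inv h"] gnorm_inv[of h] assms by simp
qed

lemma finite_gball: "finite (gball r)"
proof -
  define Q where "Q = {y \<in> hspace. hdist x0 y \<le> max r 0}"
  have "finite {g \<in> carrier G. act g ` Q \<inter> Q \<noteq> {}}"
    unfolding Q_def by (intro proper compact_hyperbolic_cball basepoint) auto
  moreover have "gball r \<subseteq> {g \<in> carrier G. act g ` Q \<inter> Q \<noteq> {}}"
  proof
    fix g assume "g \<in> gball r"
    then have g: "g \<in> carrier G" "gnorm g < r"
      by (auto simp: gball_def)
    moreover have "x0 \<in> Q"
      using basepoint by (simp add: Q_def)
    moreover have "act g x0 \<in> Q"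
      using g orbit_hspace[of g] by (simp add: Q_def gnorm_def)
    ultimately show "g \<in> {g \<in> carrier G. act g ` Q \<inter> Q \<noteq> {}}"
      by auto
  qed
  ultimately show ?thesis
    by (rule rev_finite_subset)
qed

lemma a_words_subset_carrier: "w \<in> a_words a S \<Longrightarrow> S \<subseteq> carrier G \<Longrightarrow> a \<in> carrier G \<Longrightarrow> w \<in> carrier G"
  by (induction rule: a_words.induct) auto

lemma a_words_mult:
  assumes "S \<subseteq> carrier G" "a \<in> carrier G" "w \<in> a_words a S" "v \<in> a_words a S"
  shows "w \<otimes> a \<otimes> v \<in> a_words a S"
  using assms(3)
proof (induction rule: a_words.induct)
  case (single g)
  then show ?case
    using assms by (auto intro: a_words.cons)
next
  case (cons g w)
  have "g \<in> carrier G" "w \<in> carrier G" "v \<in> carrier G"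
    using cons assms a_words_subset_carrier by blast+
  then have "(g \<otimes> a \<otimes> w) \<otimes> a \<otimes> v = g \<otimes> a \<otimes> (w \<otimes> a \<otimes> v)"
    using assms(2) by (simp add: G.m_assoc)
  then show ?case
    using a_words.cons[OF cons.hyps(1) cons.IH] by simp
qed

lemma a_words_mono: "S \<subseteq> T \<Longrightarrow> a_words a S \<subseteq> a_words a T"
proof
  fix w assume "S \<subseteq> T" "w \<in> a_words a S"
  from this(2,1) show "w \<in> a_words a T"
    by (induction rule: a_words.induct) (auto intro: a_words.intros)
qed

end

section \<open>Concatenation of Property (A) paths and near-additivity of the norm\<close>

context hyp_extension
begin

lemmas a_carrier [simp, intro] = a_b_in_G(1) and b_carrier [simp, intro] = a_b_in_G(2)

text \<open>The supremum of Gromov products is at least its term at n = m = 0, which vanishes; the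
  assumed inequalities then leave the summand 3.\<close>

lemma gnorm_a_large: "gnorm a > 3 * 10 ^ 6"
proof -
  have "gromov_product (act (a [^] (0::int)) x0) (act (b [^] (0::int)) x0) x0 \<le>
      (SUP (n::int, m::int). gromov_product (act (a [^] n) x0) (act (b [^] m) x0) x0)"
    using cSUP_upper[OF UNIV_I gromov_bounded, of "(0, 0)"] by simp
  then have "(SUP (n::int, m::int). gromov_product (act (a [^] n) x0) (act (b [^] m) x0) x0) \<ge> 0"
    by (simp add: act_one basepoint gromov_product_def)
  then have "3 * 10 ^ 6 \<le> 10 ^ 6 *
      (3 + (SUP (n::int, m::int). gromov_product (act (a [^] n) x0) (act (b [^] m) x0) x0))"
    by simp
  also note a_b_norms(2)
  also note a_b_norms(1)
  finally show ?thesis .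
qed

lemma C_large: "C > 3000"
  using gnorm_a_large by (simp add: C_def)

text \<open>The bound \<eta> + 5 of \<open>quasi_chain_middle\<close> for the tolerance \<eta> of
  Property (A). In terms of \<open>C\<close> it is \<open>C / 1000 + 5\<close>.\<close>

definition gap :: real where
  "gap = gnorm a / 10 ^ 6 + 5"

lemma gap_bounds: "0 < gap" "10 * gap + 10 \<le> C"
  using gnorm_a_large by (simp_all add: gap_def C_def)

text \<open>Property (A) for a sequence \<open>z\<^sub>0, \<dots>, z\<^sub>n\<^sub>+\<^sub>1\<close> which includes the two outer points.\<close>

definition A_path :: "(nat \<Rightarrow> 'a) \<Rightarrow> nat \<Rightarrow> 'g \<Rightarrow> bool" where
  "A_path z n h \<longleftrightarrow> n \<ge> 2 \<and> z 0 = act (inv a) x0 \<and> z 1 = x0 \<and> z n = act h x0 \<and> z (n + 1) = act (h \<otimes> a) x0 \<and>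
     (\<forall>i\<le>n+1. z i \<in> hspace) \<and> (\<forall>i<n+1. hdist (z i) (z (i + 1)) \<ge> gnorm a) \<and>
     (\<forall>i. i + 2 \<le> n + 1 \<longrightarrow> gromov_product (z i) (z (i + 2)) (z (i + 1)) \<le> gnorm a / 10 ^ 6)"

lemma property_A_iff_A_path:
  assumes "h \<in> carrier G"
  shows "property_A a h \<longleftrightarrow> (\<exists>z n. A_path z n h)"
proof
  assume "property_A a h"
  then obtain zs where zs: "length zs \<ge> 2" "set zs \<subseteq> hspace" "hd zs = x0" "last zs = act h x0"
    and step: "\<And>i. i + 1 < length ([act (inv a) x0] @ zs @ [act (h \<otimes> a) x0]) \<Longrightarrow>
        hdist (([act (inv a) x0] @ zs @ [act (h \<otimes> a) x0]) ! i)
          (([act (inv a) x0] @ zs @ [act (h \<otimes> a) x0]) ! (i + 1)) \<ge> gnorm a"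
      "\<And>i. i + 2 < length ([act (inv a) x0] @ zs @ [act (h \<otimes> a) x0]) \<Longrightarrow>
        gromov_product (([act (inv a) x0] @ zs @ [act (h \<otimes> a) x0]) ! i)
          (([act (inv a) x0] @ zs @ [act (h \<otimes> a) x0]) ! (i + 2))
          (([act (inv a) x0] @ zs @ [act (h \<otimes> a) x0]) ! (i + 1)) \<le> gnorm a / 10 ^ 6"
    unfolding property_A_def Let_def by blast
  define ps where "ps = [act (inv a) x0] @ zs @ [act (h \<otimes> a) x0]"
  have "set ps \<subseteq> hspace"
    using zs(2) assms orbit_hspace by (simp add: ps_def)
  moreover have "ps ! i \<in> set ps" if "i \<le> length zs + 1" for i
    using that by (intro nth_mem) (simp add: ps_def)
  ultimately have "ps ! i \<in> hspace" if "i \<le> length zs + 1" for i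
    using that by blast
  moreover have "ps ! 0 = act (inv a) x0" "ps ! (length zs + 1) = act (h \<otimes> a) x0"
    by (simp_all add: ps_def nth_append)
  moreover have "ps ! 1 = x0" "ps ! length zs = act h x0"
    using zs by (cases zs; force simp: ps_def nth_append last_conv_nth nth_Cons' hd_conv_nth)+
  ultimately have "A_path ((!) ps) (length zs) h"
    using zs(1) step by (simp add: A_path_def ps_def)
  then show "\<exists>z n. A_path z n h"
    by blast
next
  assume "\<exists>z n. A_path z n h"
  then obtain z n where z: "A_path z n h"
    by blast
  define zs where "zs = map (\<lambda>i. z (i + 1)) [0..<n]"
  define ps where "ps = [act (inv a) x0] @ zs @ [act (h \<otimes> a) x0]"
  have ps: "ps ! i = z i" if "i < n + 2" for i
    using that z by (auto simp: ps_def zs_def nth_append nth_Cons' A_path_def less_Suc_eq)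
  have "length zs \<ge> 2" "set zs \<subseteq> hspace" "hd zs = x0" "last zs = act h x0"
    using z by (auto simp: zs_def A_path_def hd_map last_map hd_conv_nth)
  moreover have "length ps = n + 2"
    by (simp add: ps_def zs_def)
  moreover have "hdist (ps ! i) (ps ! (i + 1)) \<ge> gnorm a" if "i + 1 < n + 2" for i
    using ps[of i] ps[of "i + 1"] that z by (simp add: A_path_def)
  moreover have "gromov_product (ps ! i) (ps ! (i + 2)) (ps ! (i + 1)) \<le> gnorm a / 10 ^ 6" if "i + 2 < n + 2" for i
    using ps[of i] ps[of "i + 1"] ps[of "i + 2"] that z by (simp add: A_path_def)
  ultimately show "property_A a h"
    unfolding property_A_def Let_def ps_def by metis
qed

text \<open>The path of g ends in g x0, g a x0. Since g a maps a^-1 x0 to g x0, the translate by g a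
  of the path of h begins with these same two points. Overlapping in a full step, the two paths
  produce no new step and no new triple. This is the purpose of the outer points in Property
  (A).\<close>

lemma A_path_concat:
  assumes g: "g \<in> carrier G" and h: "h \<in> carrier G" and z: "A_path z n g" and y: "A_path y m h"
  defines "w \<equiv> \<lambda>i. if i \<le> n then z i else act (g \<otimes> a) (y (i - n))"
  shows "A_path w (n + m) (g \<otimes> a \<otimes> h)"
proof -
  have n: "n \<ge> 2" and m: "m \<ge> 2"
    using z y by (auto simp: A_path_def)
  have y_in: "y i \<in> hspace" if "i \<le> m + 1" for i
    using y that by (simp add: A_path_def)
  have w2: "w i = act (g \<otimes> a) (y (i - n))" if "i \<ge> n" for i
  proof (cases "i = n")
    case True
    have "act (g \<otimes> a) (y 0) = act (g \<otimes> a \<otimes> inv a) x0"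
      using y g basepoint by (simp only: act_mult A_path_def G.m_closed a_carrier G.inv_closed)
    also have "g \<otimes> a \<otimes> inv a = g"
      using g by (simp add: G.m_assoc)
    finally show ?thesis
      using True z by (simp add: w_def A_path_def)
  qed (use that in \<open>simp add: w_def\<close>)
  have w1: "w i = z i" if "i \<le> n + 1" for i
  proof (cases "i = n + 1")
    case True
    then show ?thesis
      using w2[of i] z y by (simp add: A_path_def)
  qed (use that in \<open>simp add: w_def\<close>)
  have iso: "hdist (act (g \<otimes> a) u) (act (g \<otimes> a) v) = hdist u v" if "u \<in> hspace" "v \<in> hspace" for u v
    using g that by (intro isometric) auto
  have "w (n + m) = act (g \<otimes> a \<otimes> h) x0" "w (n + m + 1) = act (g \<otimes> a \<otimes> h \<otimes> a) x0"
    using w2[of "n + m"] w2[of "n + m + 1"] y g h basepoint act_mult[of "g \<otimes> a" h x0]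
      act_mult[of "g \<otimes> a" "h \<otimes> a" x0]
    by (simp_all add: A_path_def G.m_assoc)
  moreover have "w i \<in> hspace" if "i \<le> n + m + 1" for i
  proof (cases "i \<le> n")
    case True
    then show ?thesis using w1[of i] z by (simp add: A_path_def)
  next
    case False
    then have "y (i - n) \<in> hspace"
      using that by (intro y_in) auto
    then show ?thesis using w2[of i] False g by (simp)
  qed
  moreover have "hdist (w i) (w (i + 1)) \<ge> gnorm a" if "i < n + m + 1" for i
  proof (cases "i \<le> n")
    case True
    then show ?thesis using w1[of i] w1[of "i + 1"] z by (simp add: A_path_def)
  next
    case False
    define j where "j = i - n"
    have j: "i = n + j" "j < m + 1"
      using False that by (auto simp: j_def)
    then have "hdist (w i) (w (i + 1)) = hdist (y j) (y (j + 1))"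
      using w2[of i] w2[of "i + 1"] iso[OF y_in[of j] y_in[of "j + 1"]] by simp
    then show ?thesis using y j by (simp add: A_path_def)
  qed
  moreover have "gromov_product (w i) (w (i + 2)) (w (i + 1)) \<le> gnorm a / 10 ^ 6" if "i + 2 \<le> n + m + 1" for i
  proof (cases "i + 2 \<le> n + 1")
    case True
    then show ?thesis using w1[of i] w1[of "i + 1"] w1[of "i + 2"] z by (simp add: A_path_def)
  next
    case False
    define j where "j = i - n"
    have j: "i = n + j" "j + 2 \<le> m + 1"
      using False that by (auto simp: j_def)
    then have "gromov_product (w i) (w (i + 2)) (w (i + 1)) = gromov_product (y j) (y (j + 2)) (y (j + 1))"
      using w2[of i] w2[of "i + 1"] w2[of "i + 2"] y_in[of j] y_in[of "j + 1"] y_in[of "j + 2"]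
      by (simp add: gromov_product_def iso)
    then show ?thesis using y j by (simp add: A_path_def)
  qed
  moreover have "w 0 = act (inv a) x0" "w 1 = x0"
    using z n w1[of 0] w1[of 1] by (simp_all add: A_path_def)
  ultimately show ?thesis
    unfolding A_path_def using m by simp
qed

text \<open>On the concatenated path x0, g x0 and the orbit point of the whole word have indices 1,
  n and n + m, so the chain estimate applies to them.\<close>

lemma
  assumes g: "g \<in> carrier G" "property_A a g" and h: "h \<in> carrier G" "property_A a h"
  shows property_A_concat: "property_A a (g \<otimes> a \<otimes> h)"
    and gromov_product_concat: "gromov_product x0 (act (g \<otimes> a \<otimes> h) x0) (act g x0) \<le> gap"
proof -
  obtain z n where z: "A_path z n g"
    using g(2) unfolding property_A_iff_A_path[OF g(1)] by blast
  obtain y m where y: "A_path y m h"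
    using h(2) unfolding property_A_iff_A_path[OF h(1)] by blast
  define w where "w = (\<lambda>i. if i \<le> n then z i else act (g \<otimes> a) (y (i - n)))"
  have w: "A_path w (n + m) (g \<otimes> a \<otimes> h)"
    unfolding w_def using g h z y by (intro A_path_concat)
  then show "property_A a (g \<otimes> a \<otimes> h)"
    using property_A_iff_A_path[of "g \<otimes> a \<otimes> h"] g(1) h(1) by blast
  have "gromov_product (w 1) (w (n + m)) (w n) \<le> gnorm a / 10 ^ 6 + 5"
  proof (rule quasi_chain_middle[where n = "n + m + 1" and L = "gnorm a"])
    show "2 * (gnorm a / 10 ^ 6) + 15 / 2 < gnorm a"
      using gnorm_a_large by simp
    next
    show "1 < n" "n < n + m" "n + m \<le> n + m + 1"
      using z y by (simp_all add: A_path_def)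
  qed (use w in \<open>auto simp: A_path_def\<close>)
  then show "gromov_product x0 (act (g \<otimes> a \<otimes> h) x0) (act g x0) \<le> gap"
    using w z by (simp add: A_path_def w_def gap_def)
qed

text \<open>Near-additivity makes the weight of a word p a v at most a constant times the product of
  the weights of p and v. The summand \<open>gnorm a\<close> allows for the letter a leading
  backwards.\<close>

lemma gnorm_concat_ge:
  assumes g: "g \<in> carrier G" "property_A a g" and h: "h \<in> carrier G" "property_A a h"
  shows "gnorm (g \<otimes> a \<otimes> h) \<ge> gnorm g + gnorm h - gnorm a - 2 * gap"
proof -
  have "hdist (act g x0) (act (g \<otimes> a \<otimes> h) x0) = gnorm (a \<otimes> h)"
    using hdist_act_mult[of g "a \<otimes> h"] g h by (simp add: G.m_assoc)
  also have "\<dots> \<ge> gnorm h - gnorm a"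
    using h by (intro gnorm_mult_ge_left) auto
  finally show ?thesis
    using gromov_product_concat[OF g h] by (simp add: gromov_product_def gnorm_def)
qed

text \<open>Both g x0 and h x0 lie close to the geodesic from x0 to the common orbit point p, so
  their products with p at x0 nearly equal their norms. By hyperbolicity so does their mutual
  product, and little but the difference of the norms separates them.\<close>

lemma common_word_imp_near:
  assumes g: "g \<in> carrier G" "property_A a g" and h: "h \<in> carrier G" "property_A a h"
    and v: "v \<in> carrier G" "property_A a v" and w: "w \<in> carrier G" "property_A a w"
    and eq: "g \<otimes> a \<otimes> v = h \<otimes> a \<otimes> w"
  shows "hdist (act g x0) (act h x0) \<le> \<bar>gnorm g - gnorm h\<bar> + 2 * gap + 5"
proof -
  define p where "p = act (g \<otimes> a \<otimes> v) x0"
  have "gromov_product (act g x0) p x0 = gnorm g - gromov_product x0 p (act g x0)"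
    "gromov_product (act h x0) p x0 = gnorm h - gromov_product x0 p (act h x0)"
    by (simp_all add: gromov_product_base_change[of _ p x0] gnorm_def hdist_commute)
  moreover have "gromov_product x0 p (act g x0) \<le> gap" "gromov_product x0 p (act h x0) \<le> gap"
    using gromov_product_concat[OF g v] gromov_product_concat[OF h w] eq by (simp_all add: p_def)
  moreover have "gromov_product (act g x0) (act h x0) x0 \<ge>
      min (gromov_product (act g x0) p x0) (gromov_product (act h x0) p x0) - 5 / 2"
    unfolding p_def gromov_product_commute[of "act h x0"] using g h v basepoint
    using gromov_product_hyperbolic[of "act g x0" p "act h x0" x0]
    by (simp add: p_def gromov_product_commute orbit_hspace)
  ultimately have "gromov_product (act g x0) (act h x0) x0 \<ge> min (gnorm g) (gnorm h) - gap - 5 / 2"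
    by linarith
  then show ?thesis
    by (simp add: gromov_product_def gnorm_def hdist_commute min_def abs_if split: if_splits)
qed

lemma gnorm_\<Phi>_ge:
  assumes g: "g \<in> carrier G" and long: "gnorm g \<ge> gnorm a"
  shows "gnorm (\<Phi> g) \<ge> gnorm g - 2 * gnorm b"
proof (cases "property_A a g")
  case True
  then show ?thesis
    using \<Phi>_fix[OF g] gnorm_nonneg[of b] by simp
next
  case False
  have 1: "gnorm (b \<otimes> g) \<ge> gnorm g - gnorm b" "gnorm (g \<otimes> b) \<ge> gnorm g - gnorm b"
    "gnorm (b \<otimes> g \<otimes> b) \<ge> gnorm (b \<otimes> g) - gnorm b"
    using g by (auto intro: gnorm_mult_ge_left gnorm_mult_ge_right)
  then show ?thesis
    using \<Phi>_long[OF g False long] gnorm_nonneg[of b] by auto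
qed

lemma a_words_property_A:
  assumes "S \<subseteq> {g \<in> carrier G. property_A a g}" "w \<in> a_words a S"
  shows "w \<in> carrier G" "property_A a w"
proof -
  from assms(2) have "w \<in> carrier G \<and> property_A a w"
  proof (induction rule: a_words.induct)
    case (cons g w)
    then show ?case
      using assms(1) property_A_concat by auto
  qed (use assms(1) in auto)
  then show "w \<in> carrier G" "property_A a w"
    by auto
qed

end

section \<open>Weights and the critical exponent\<close>

context hyp_action
begin

text \<open>As a measure on all subsets of the group type, the weights come with subadditivity,
  monotonicity and transport along injections.\<close>

definition wmeas :: "real \<Rightarrow> 'g measure" where
  "wmeas s = density (count_space UNIV) (\<lambda>g. ennreal (exp (- s * gnorm g)))"

lemma sets_wmeas [simp]: "sets (wmeas s) = UNIV"
  by (simp add: wmeas_def)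

lemma emeasure_wmeas: "emeasure (wmeas s) A = (\<integral>\<^sup>+g. ennreal (exp (- s * gnorm g)) \<partial>count_space A)"
proof -
  have "emeasure (wmeas s) A = (\<integral>\<^sup>+g. ennreal (exp (- s * gnorm g)) * indicator A g \<partial>count_space UNIV)"
    unfolding wmeas_def by (subst emeasure_density) auto
  then show ?thesis
    by (simp add: nn_integral_count_space_indicator)
qed

lemma poincare_eq_wmeas: "countable A \<Longrightarrow> poincare A s = emeasure (wmeas s) A"
  by (simp add: poincare_def emeasure_wmeas infsum_ennreal_eq_nn_integral)

lemma emeasure_wmeas_image:
  "inj_on h A \<Longrightarrow> emeasure (wmeas s) (h ` A) = (\<integral>\<^sup>+g. ennreal (exp (- s * gnorm (h g))) \<partial>count_space A)"
  unfolding emeasure_wmeas by (rule nn_integral_bij_count_space[OF inj_on_imp_bij_betw, symmetric])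

lemma emeasure_wmeas_singleton: "emeasure (wmeas s) {g} = ennreal (exp (- s * gnorm g))"
  by (simp add: emeasure_wmeas nn_integral_count_space_finite)

lemma emeasure_wmeas_antimono:
  assumes "A \<subseteq> carrier G" "s \<le> t"
  shows "emeasure (wmeas t) A \<le> emeasure (wmeas s) A"
  unfolding emeasure_wmeas
proof (intro nn_integral_mono ennreal_leI)
  fix g assume "g \<in> space (count_space A)"
  then have "gnorm g \<ge> 0"
    using assms(1) by (auto intro: gnorm_nonneg)
  then show "exp (- t * gnorm g) \<le> exp (- s * gnorm g)"
    using assms(2) by (simp add: mult_right_mono)
qed

lemma emeasure_ps_approx:
  assumes "A \<subseteq> carrier G" and B: "B \<in> sets (restrict_space borel orbit_with_boundary)"
  shows "emeasure (ps_approx A s) B = emeasure (wmeas s) {g \<in> A. act g x0 \<in> B} / poincare A s"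
proof -
  let ?D = "density (count_space A) (\<lambda>g. ennreal (exp (- s * gnorm g)) / poincare A s)"
  have "(\<lambda>g. act g x0) \<in> measurable (count_space A) (restrict_space borel orbit_with_boundary)"
    using assms(1) by (auto simp: orbit_with_boundary_def orb_def space_restrict_space)
  then have "(\<lambda>g. act g x0) \<in> measurable ?D (restrict_space borel orbit_with_boundary)"
    by simp
  from emeasure_distr[OF this B]
  have "emeasure (ps_approx A s) B = emeasure ?D ((\<lambda>g. act g x0) -` B \<inter> A)"
    by (simp add: ps_approx_def)
  also have "\<dots> = (\<integral>\<^sup>+g. ennreal (exp (- s * gnorm g)) / poincare A s *
      indicator ((\<lambda>g. act g x0) -` B \<inter> A) g \<partial>count_space A)"
    by (rule emeasure_density) auto
  also have "\<dots> = (\<integral>\<^sup>+g. ennreal (exp (- s * gnorm g)) * indicator {g \<in> A. act g x0 \<in> B} g / poincare A s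
      \<partial>count_space A)"
    by (intro nn_integral_cong) (auto simp: indicator_def)
  also have "\<dots> = (\<integral>\<^sup>+g. ennreal (exp (- s * gnorm g)) * indicator {g \<in> A. act g x0 \<in> B} g \<partial>count_space A)
      / poincare A s"
    by (rule nn_integral_divide) auto
  also have "(\<integral>\<^sup>+g. ennreal (exp (- s * gnorm g)) * indicator {g \<in> A. act g x0 \<in> B} g \<partial>count_space A) =
      (\<integral>\<^sup>+g. ennreal (exp (- s * gnorm g)) * indicator {g \<in> A. act g x0 \<in> B} g \<partial>count_space UNIV)"
  proof -
    have "(\<integral>\<^sup>+g. f g \<partial>count_space A) = (\<integral>\<^sup>+g. f g * indicator A g \<partial>count_space UNIV)" for f :: "'g \<Rightarrow> ennreal"
      by (rule nn_integral_count_space_indicator) (simp add: NO_MATCH_def)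
    then show ?thesis
      by (simp only:) (intro nn_integral_cong, auto simp: indicator_def)
  qed
  also have "\<dots> = emeasure (wmeas s) {g \<in> A. act g x0 \<in> B}"
    unfolding wmeas_def by (subst emeasure_density) auto
  finally show ?thesis .
qed

lemma exponential_growth_nonneg:
  assumes growth: "\<And>r. r \<ge> r0 \<Longrightarrow> real (card (gball r)) \<le> exp (c * r)"
  shows "c \<ge> 0"
proof -
  define r where "r = max r0 1"
  have "\<one> \<in> gball r"
    by (simp add: gball_def gnorm_one r_def)
  then have "card (gball r) > 0"
    using finite_gball by (auto simp: card_gt_0_iff)
  then have "1 \<le> real (card (gball r))"
    by simp
  also have "\<dots> \<le> exp (c * r)"
    by (intro growth) (simp add: r_def)
  finally have "c * r \<ge> 0"
    by simp
  then show ?thesis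
    by (simp add: r_def zero_le_mult_iff)
qed

text \<open>In shells of width 1 the counting bound and the weight with exponent c + 1 leave a
  geometric series of ratio 1/e. The purpose is to exhibit an exponent of convergence, so that the
  infimum in \<open>crit_exp\<close> is taken over a nonempty set.\<close>

lemma emeasure_wmeas_finite_of_exponential_growth:
  assumes "r0 \<ge> 0" and growth: "\<And>r. r \<ge> r0 \<Longrightarrow> real (card (gball r)) \<le> exp (c * r)"
  shows "emeasure (wmeas (c + 1)) (carrier G) < \<infinity>"
proof -
  have c: "c \<ge> 0"
    using growth by (rule exponential_growth_nonneg)
  define A where "A n = {g \<in> carrier G. real n \<le> gnorm g \<and> gnorm g < real n + 1}" for n :: nat
  have "g \<in> (\<Union>n. A n)" if "g \<in> carrier G" for g
    using that gnorm_nonneg[OF that] by (intro UN_I[of "nat \<lfloor>gnorm g\<rfloor>"]) (auto simp: A_def)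
  then have "emeasure (wmeas (c + 1)) (carrier G) \<le> emeasure (wmeas (c + 1)) (\<Union>n. A n)"
    by (intro emeasure_mono) auto
  also have "\<dots> \<le> (\<Sum>n. emeasure (wmeas (c + 1)) (A n))"
    by (rule emeasure_subadditive_countably) auto
  also have "\<dots> \<le> (\<Sum>n. ennreal (exp (c * (1 + r0)) * exp (- 1) ^ n))"
  proof (intro suminf_le)
    fix n
    \<comment> \<open>The radius is enlarged by \<open>r0\<close> so that the growth bound,
      available from \<open>r0\<close> on, covers every shell.\<close>
    have sub: "A n \<subseteq> gball (real n + 1 + r0)"
      using assms(1) by (auto simp: A_def gball_def)
    then have fin: "finite (A n)"
      using finite_gball finite_subset by blast
    have "emeasure (wmeas (c + 1)) (A n) = (\<Sum>g\<in>A n. ennreal (exp (- (c + 1) * gnorm g)))"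
      by (simp add: emeasure_wmeas nn_integral_count_space_finite fin)
    also have "\<dots> \<le> (\<Sum>g\<in>A n. ennreal (exp (- (c + 1) * real n)))"
    proof (intro sum_mono ennreal_leI)
      fix g assume "g \<in> A n"
      then have "(c + 1) * real n \<le> (c + 1) * gnorm g"
        using c by (intro mult_left_mono) (auto simp: A_def)
      then show "exp (- (c + 1) * gnorm g) \<le> exp (- (c + 1) * real n)"
        by (simp only: exp_le_cancel_iff mult_minus_left neg_le_iff_le)
    qed
    also have "\<dots> = ennreal (real (card (A n)) * exp (- (c + 1) * real n))"
      by (simp add: ennreal_mult'' ennreal_of_nat_eq_real_of_nat)
    also have "\<dots> \<le> ennreal (exp (c * (real n + 1 + r0)) * exp (- (c + 1) * real n))"
    proof (intro ennreal_leI mult_right_mono)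
      have "real (card (A n)) \<le> real (card (gball (real n + 1 + r0)))"
        using card_mono[OF finite_gball sub] by simp
      also have "\<dots> \<le> exp (c * (real n + 1 + r0))"
        by (intro growth) auto
      finally show "real (card (A n)) \<le> exp (c * (real n + 1 + r0))" .
    qed auto
    also have "exp (c * (real n + 1 + r0)) * exp (- (c + 1) * real n) = exp (c * (1 + r0)) * exp (- 1) ^ n"
      by (simp add: exp_add[symmetric] exp_of_nat_mult[symmetric] algebra_simps)
    finally show "emeasure (wmeas (c + 1)) (A n) \<le> ennreal (exp (c * (1 + r0)) * exp (- 1) ^ n)" .
  qed auto
  also have "\<dots> = ennreal (exp (c * (1 + r0)) * (1 / (1 - exp (- 1))))"
    by (intro suminf_ennreal_eq sums_mult geometric_sums) auto
  also have "\<dots> < \<infinity>"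
    by simp
  finally show ?thesis .
qed

end

section \<open>Separated letters in K and a positive lower bound for the critical exponent\<close>

context F_construction
begin

text \<open>The growth bound excludes negative values, and for the value 0 the condition on
  \<open>R 0\<close> would read 0 > 10^7 (C + r0).\<close>

lemma crit_exp_carrier_pos: "crit_exp (carrier G) > 0"
proof -
  have "(1 + 0.001 * \<epsilon>) * crit_exp (carrier G) \<ge> 0"
    using r0_growth by (rule exponential_growth_nonneg)
  then have "crit_exp (carrier G) \<ge> 0"
    using \<epsilon>_bounds by (simp add: zero_le_mult_iff)
  moreover have "crit_exp (carrier G) \<noteq> 0"
    using R0_large C_large r0_nonneg by auto
  ultimately show ?thesis
    by simp
qed

lemma
  shows R0_pos: "R 0 > 1"
    and \<epsilon>R0_large: "\<epsilon> * R 0 > 10 ^ 7 * (C + r0)"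
    and crit_\<epsilon>R0_large: "crit_exp (carrier G) * (\<epsilon> * R 0) > 10 ^ 7"
proof -
  let ?d = "crit_exp (carrier G)"
  have d: "?d > 0"
    by (rule crit_exp_carrier_pos)
  define q where "q = 10 ^ 7 * (C + r0)"
  have q: "q > 10 ^ 7"
    using C_large r0_nonneg by (simp add: q_def)
  have "?d * (\<epsilon> * R 0) > q * (1 + ?d)"
    using R0_large by (simp add: q_def ac_simps)
  then have *: "q + ?d * q < ?d * (\<epsilon> * R 0)"
    by (simp add: algebra_simps)
  moreover have "?d * q > 0"
    using d q by simp
  ultimately show "?d * (\<epsilon> * R 0) > 10 ^ 7"
    using q by linarith
  have "?d * q < ?d * (\<epsilon> * R 0)"
    using * less_trans[OF _ q, of 0] by simp
  then show 1: "\<epsilon> * R 0 > 10 ^ 7 * (C + r0)"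
    using d by (simp add: q_def)
  have "\<epsilon> * R 0 > 1"
    using 1 q by (simp add: q_def)
  then have "R 0 > 0"
    using \<epsilon>_bounds by (metis zero_less_mult_pos zero_less_one less_trans)
  then have "\<epsilon> * R 0 \<le> R 0"
    using \<epsilon>_bounds by simp
  then show "R 0 > 1"
    using \<open>\<epsilon> * R 0 > 1\<close> by linarith
qed

lemma K_norm: "g \<in> K \<Longrightarrow> g \<in> carrier G \<and> (1 - 0.003 * \<epsilon>) * R 0 \<le> gnorm g \<and> gnorm g < R 0"
  using K_separated(1) by (auto simp: shell_def gball_def)

text \<open>By maximality, orbit balls of radius 0.004 \<epsilon> R_0 around K cover the shell. With
  at most one centre the shell would have no more elements than a tiny ball, and together with the
  inner ball it could not reach the lower growth bound at \<open>R 0\<close>.\<close>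

lemma K_nontrivial: "\<exists>g\<in>K. \<exists>h\<in>K. g \<noteq> h"
proof (rule ccontr)
  assume "\<not> ?thesis"
  then have one: "g = h" if "g \<in> K" "h \<in> K" for g h
    using that by blast
  define \<rho> where "\<rho> = 0.004 * \<epsilon> * R 0"
  define S where "S = shell \<epsilon> (R 0)"
  let ?d = "crit_exp (carrier G)"
  have \<rho>: "\<rho> \<ge> 0" "\<rho> < 0.005 * \<epsilon> * R 0"
    using R0_pos \<epsilon>_bounds by (auto simp: \<rho>_def)
  have S_carrier: "S \<subseteq> carrier G"
    by (auto simp: S_def shell_def gball_def)
  have cover: "\<exists>k\<in>K. hdist (act s x0) (act k x0) \<le> \<rho>" if s: "s \<in> S" for s
  proof (rule ccontr)
    assume far: "\<not> ?thesis"
    then have "s \<notin> K"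
      using \<rho> by auto
    have "insert s K = K"
    proof (rule K_maximal)
      show "insert s K \<subseteq> shell \<epsilon> (R 0)"
        using s K_separated(1) by (simp add: S_def)
      show "separated (0.004 * \<epsilon> * R 0) (insert s K)"
        using far K_separated(2) unfolding separated_def \<rho>_def[symmetric]
        by (auto simp: not_le hdist_commute)
    qed auto
    then show False
      using \<open>s \<notin> K\<close> by auto
  qed
  \<comment> \<open>Maximality gives only distance at most \<rho>, while \<open>gball\<close> is an
    open ball; hence a radius slightly above \<rho>.\<close>
  have card_S: "card S \<le> card (gball (0.005 * \<epsilon> * R 0))"
  proof (cases "S = {}")
    case False
    then obtain k where k: "k \<in> K" "\<And>s. s \<in> S \<Longrightarrow> hdist (act s x0) (act k x0) \<le> \<rho>"
      using cover one by (metis ex_in_conv)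
    have kG: "k \<in> carrier G"
      using K_norm[OF k(1)] by simp
    show ?thesis
    proof (rule card_inj_on_le)
      show "inj_on (\<lambda>s. inv k \<otimes> s) S"
        using S_carrier kG by (intro inj_onI) (metis G.inv_closed G.Units_eq G.Units_l_cancel subsetD)
      show "(\<lambda>s. inv k \<otimes> s) ` S \<subseteq> gball (0.005 * \<epsilon> * R 0)"
      proof (intro subsetI, elim imageE)
        fix x s assume x: "x = inv k \<otimes> s" "s \<in> S"
        then have "gnorm x \<le> \<rho>"
          using k(2)[of s] S_carrier kG hdist_orbit[of k s] by (auto simp: hdist_commute)
        then show "x \<in> gball (0.005 * \<epsilon> * R 0)"
          using \<rho> x S_carrier kG by (auto simp: gball_def)
      qed
    qed (rule finite_gball)
  qed simp
  \<comment> \<open>In X, Y and Z all exponents are linear. Both exponents on the upper side fall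
    short of A by more than 0.001 Y > 10^4 - in particular by 2, and 2 exp (A - 2) < exp A is the
    contradiction.\<close>
  define X where "X = ?d * R 0"
  define Y where "Y = ?d * (\<epsilon> * R 0)"
  have Y: "Y > 10 ^ 7"
    using crit_\<epsilon>R0_large by (simp add: Y_def)
  have XY: "Y \<le> X"
    using crit_exp_carrier_pos \<epsilon>_bounds R0_pos by (simp add: X_def Y_def)
  define Z where "Z = \<epsilon> * Y"
  have Z: "0 \<le> Z" "Z \<le> Y"
    using \<epsilon>_bounds Y by (auto simp: Z_def)
  have \<epsilon>R: "\<epsilon> * R 0 > 10 ^ 7 * r0" "\<epsilon> * R 0 \<le> R 0"
    using \<epsilon>R0_large C_large \<epsilon>_bounds R0_pos by auto
  define A where "A = (1 - 0.001 * \<epsilon>) * ?d * R 0"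
  have A: "A = X - 0.001 * Y"
    by (simp add: A_def X_def Y_def algebra_simps)
  have "real (card (gball (R 0) \<inter> \<Phi> ` carrier G)) \<le>
      real (card (S \<union> gball ((1 - 0.003 * \<epsilon>) * R 0)))"
    using finite_gball S_carrier
    by (intro of_nat_mono card_mono) (auto simp: S_def shell_def)
  also have "\<dots> \<le> real (card S) + real (card (gball ((1 - 0.003 * \<epsilon>) * R 0)))"
    using card_Un_le[of S "gball ((1 - 0.003 * \<epsilon>) * R 0)"] by linarith
  also have "\<dots> \<le> real (card (gball (0.005 * \<epsilon> * R 0))) + real (card (gball ((1 - 0.003 * \<epsilon>) * R 0)))"
    using card_S by simp
  also have "\<dots> \<le> exp ((1 + 0.001 * \<epsilon>) * ?d * (0.005 * \<epsilon> * R 0)) +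
      exp ((1 + 0.001 * \<epsilon>) * ?d * ((1 - 0.003 * \<epsilon>) * R 0))"
    using \<epsilon>R r0_nonneg by (intro add_mono r0_growth) (auto simp: algebra_simps)
  also have "\<dots> \<le> exp (A - 2) + exp (A - 2)"
  proof (intro add_mono)
    have *: "(1 + 0.001 * \<epsilon>) * ?d * (0.005 * \<epsilon> * R 0) = 0.005 * Y + 0.000005 * Z"
      by (simp add: Z_def Y_def algebra_simps)
    show "exp ((1 + 0.001 * \<epsilon>) * ?d * (0.005 * \<epsilon> * R 0)) \<le> exp (A - 2)"
      unfolding A exp_le_cancel_iff * using XY Y Z by simp
    have **: "(1 + 0.001 * \<epsilon>) * ?d * ((1 - 0.003 * \<epsilon>) * R 0) = X - 0.002 * Y - 0.000003 * Z"
      by (simp add: Z_def X_def Y_def algebra_simps)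
    show "exp ((1 + 0.001 * \<epsilon>) * ?d * ((1 - 0.003 * \<epsilon>) * R 0)) \<le> exp (A - 2)"
      unfolding A exp_le_cancel_iff ** using XY Y Z by simp
  qed
  finally have "exp A \<le> exp (A - 2) + exp (A - 2)"
    using R0_growth by (simp add: A_def)
  moreover have "exp A = exp (A - 2) * exp 2"
    by (simp add: exp_add[symmetric])
  moreover have "exp (A - 2) * exp 2 \<ge> exp (A - 2) * 3"
    using exp_ge_add_one_self[of 2] by (intro mult_left_mono) auto
  moreover have "exp (A - 2) > 0"
    by simp
  ultimately show False
    by linarith
qed

definition gens :: "'g set" where
  "gens = K \<union> \<phi> ` {1..}"

abbreviation F :: "'g set" where
  "F \<equiv> F_total K \<phi>"

lemma enum_carrier: "1 \<le> k \<Longrightarrow> enum k \<in> carrier G"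
  using enumeration by auto

lemma \<phi>'_carrier: "1 \<le> k \<Longrightarrow> \<phi>' k \<in> carrier G"
  using \<phi>'_choice[of k] by (auto simp: O_set_def)

lemma gens_property_A: "gens \<subseteq> {g \<in> carrier G. property_A a g}"
proof -
  have "K \<subseteq> {g \<in> carrier G. property_A a g}"
    using K_separated(1) \<Phi>_range by (auto simp: shell_def)
  moreover have "\<phi> k \<in> {g \<in> carrier G. property_A a g}" if "1 \<le> k" for k
    using that \<phi>_eq[OF that] \<Phi>_range[OF enum_carrier[OF that]] \<Phi>_range[OF \<phi>'_carrier[OF that]]
      property_A_concat by auto
  ultimately show ?thesis
    by (auto simp: gens_def)
qed

lemma gens_carrier: "gens \<subseteq> carrier G"
  using gens_property_A by auto

lemma F_eq_a_words: "F = a_words a gens"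
proof
  show "F \<subseteq> a_words a gens"
    unfolding F_total_def F_stage_def gens_def by (intro UN_least a_words_mono) auto
  have gens: "\<exists>k\<ge>1. g \<in> K \<union> \<phi> ` {1..<k}" if "g \<in> gens" for g
  proof (cases "g \<in> K")
    case False
    then obtain j where "j \<ge> 1" "g = \<phi> j"
      using \<open>g \<in> gens\<close> by (auto simp: gens_def)
    then show ?thesis
      by (intro exI[of _ "j + 1"]) auto
  qed auto
  show "a_words a gens \<subseteq> F"
  proof
    fix w assume "w \<in> a_words a gens"
    then have "\<exists>k\<ge>1. w \<in> a_words a (K \<union> \<phi> ` {1..<k})"
    proof (induction rule: a_words.induct)
      case (single g)
      then show ?case
        using gens a_words.single by metis
    next
      case (cons g w)
      then obtain j k where jk: "j \<ge> 1" "w \<in> a_words a (K \<union> \<phi> ` {1..<j})"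
        "k \<ge> 1" "g \<in> K \<union> \<phi> ` {1..<k}"
        using gens by metis
      have "g \<in> K \<union> \<phi> ` {1..<max j k}"
        using jk by auto
      moreover have "w \<in> a_words a (K \<union> \<phi> ` {1..<max j k})"
      proof (rule subsetD[OF a_words_mono jk(2)])
        show "K \<union> \<phi> ` {1..<j} \<subseteq> K \<union> \<phi> ` {1..<max j k}"
          by (intro Un_mono image_mono) auto
      qed
      ultimately show ?case
        using jk(1) by (intro exI[of _ "max j k"]) (auto intro: a_words.cons)
    qed
    then show "w \<in> F"
      by (auto simp: F_total_def F_stage_def)
  qed
qed

lemma F_property_A: "w \<in> F \<Longrightarrow> w \<in> carrier G" "w \<in> F \<Longrightarrow> property_A a w"
  using a_words_property_A[OF gens_property_A] by (auto simp: F_eq_a_words)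

lemma F_carrier: "F \<subseteq> carrier G"
  using F_property_A by blast

lemma countable_F: "countable F"
  by (rule countable_subset[OF F_carrier], subst enumeration[symmetric]) simp

lemma F_mult: "w \<in> F \<Longrightarrow> v \<in> F \<Longrightarrow> w \<otimes> a \<otimes> v \<in> F"
  unfolding F_eq_a_words by (intro a_words_mult gens_carrier a_carrier)

lemma gens_F: "gens \<subseteq> F"
  by (auto simp: F_eq_a_words intro: a_words.single)

lemma R_ge: "R k \<ge> real k + 1"
proof (induction k)
  case 0
  then show ?case using R0_pos by simp
next
  case (Suc k)
  then show ?case using R_large[of "Suc k"] by simp
qed

text \<open>The surplus 2500 C in the choice of \<open>\<phi>' k\<close> pays for at most 2 C lost
  under \<Phi>, for \<open>gnorm a\<close> = 1000 C and for 2 \<open>gap\<close> \<le> C lost in the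
  concatenation.\<close>

lemma gnorm_\<phi>_ge:
  assumes "1 \<le> k"
  shows "gnorm (\<phi> k) \<ge> real k"
proof -
  have gp: "gnorm (\<phi>' k) \<ge> R k + 2500 * C"
    using \<phi>'_choice[OF assms] \<phi>'_carrier[OF assms] by (auto simp: gball_def)
  have "gnorm (\<Phi> (\<phi>' k)) \<ge> gnorm (\<phi>' k) - 2 * gnorm b"
    using gp R_ge[of k] C_large by (intro gnorm_\<Phi>_ge \<phi>'_carrier assms) (simp add: C_def)
  moreover have "gnorm b \<le> C"
    using a_b_norms(1) by (simp add: C_def)
  moreover have "gnorm (\<phi> k) \<ge> gnorm (\<Phi> (\<phi>' k)) + gnorm (\<Phi> (enum k)) - gnorm a - 2 * gap"
    unfolding \<phi>_eq[OF assms] using \<Phi>_range[OF \<phi>'_carrier[OF assms]] \<Phi>_range[OF enum_carrier[OF assms]]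
    by (intro gnorm_concat_ge) auto
  moreover have "gnorm (\<Phi> (enum k)) \<ge> 0"
    using \<Phi>_range[OF enum_carrier[OF assms]] by (intro gnorm_nonneg) auto
  moreover have "gnorm a = 1000 * C"
    by (simp add: C_def)
  ultimately show ?thesis
    using gp gap_bounds R_ge[of k] C_large by linarith
qed

text \<open>A common word would put g x0 and h x0 at a distance not much above the difference of
  their norms. That difference is at most the shell width 0.003 \<epsilon> R_0, the separation
  exceeds 0.004 \<epsilon> R_0, and the margin 0.001 \<epsilon> R_0 > 10^4 C beats the
  error.\<close>

lemma K_words_disjoint:
  assumes "g \<in> K" "h \<in> K" "g \<noteq> h" "v \<in> F" "w \<in> F"
  shows "g \<otimes> a \<otimes> v \<noteq> h \<otimes> a \<otimes> w"
proof
  assume eq: "g \<otimes> a \<otimes> v = h \<otimes> a \<otimes> w"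
  have gh: "g \<in> F" "h \<in> F"
    using assms gens_F by (auto simp: gens_def)
  have "hdist (act g x0) (act h x0) \<le> \<bar>gnorm g - gnorm h\<bar> + 2 * gap + 5"
    using assms gh by (intro common_word_imp_near[OF _ _ _ _ _ _ _ _ eq] F_property_A)
  moreover have "\<bar>gnorm g - gnorm h\<bar> \<le> 0.003 * \<epsilon> * R 0"
  proof -
    have "(1 - 0.003 * \<epsilon>) * R 0 = R 0 - 0.003 * \<epsilon> * R 0"
      by (simp add: algebra_simps)
    then show ?thesis
      using K_norm[OF assms(1)] K_norm[OF assms(2)] by linarith
  qed
  moreover have "hdist (act g x0) (act h x0) > 0.004 * \<epsilon> * R 0"
    using K_separated(2) assms by (auto simp: separated_def)
  moreover have "\<epsilon> * R 0 > 10 ^ 7 * C"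
    using \<epsilon>R0_large r0_nonneg by simp
  ultimately show False
    using gap_bounds C_large by simp
qed

text \<open>The solution s of \<open>2 * exp (- s * (R 0 + gnorm a)) = 1\<close>: below it, two
  disjoint copies of F would outweigh F.\<close>

definition growth_bound :: real where
  "growth_bound = ln 2 / (R 0 + gnorm a)"

lemma growth_bound_pos: "growth_bound > 0"
  using R0_pos gnorm_a_large by (simp add: growth_bound_def)

lemma F_nonempty: "F \<noteq> {}"
  using K_nontrivial gens_F by (auto simp: gens_def)

lemma poincare_F: "poincare F s = emeasure (wmeas s) F"
  by (rule poincare_eq_wmeas[OF countable_F])

lemma poincare_F_ge: "g \<in> F \<Longrightarrow> ennreal (exp (- s * gnorm g)) \<le> poincare F s"
  unfolding poincare_F emeasure_wmeas_singleton[symmetric] by (intro emeasure_mono) auto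

lemma poincare_F_pos: "poincare F s > 0"
proof -
  obtain g where "g \<in> F"
    using F_nonempty by auto
  from poincare_F_ge[OF this, of s] show ?thesis
    by (rule less_le_trans[rotated]) simp
qed

lemma inj_on_left_mult: "p \<in> carrier G \<Longrightarrow> inj_on (\<lambda>v. p \<otimes> v) F"
  using F_carrier by (intro inj_onI) (metis G.Units_eq G.Units_l_cancel subsetD)

text \<open>For distinct \<open>g, h \<in> K\<close> the sets \<open>g a F\<close> and \<open>h a F\<close> are disjoint subsets of \<open>F\<close>, and each has
  at least \<open>exp (- s (R\<^sub>0 + \<parallel>a\<parallel>))\<close> times the weight of \<open>F\<close>.\<close>

lemma growth_bound_le_if_nonneg:
  assumes fin: "poincare F s < \<infinity>" and s: "s \<ge> 0"
  shows "growth_bound \<le> s"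
proof -
  obtain g h where gh: "g \<in> K" "h \<in> K" "g \<noteq> h"
    using K_nontrivial by blast
  define c where "c = exp (- s * (R 0 + gnorm a))"
  define P where "P = enn2real (poincare F s)"
  \<comment> \<open>Finiteness makes the series a positive real P, which can be cancelled from the
    final inequality.\<close>
  have P: "poincare F s = ennreal P" "P > 0"
    using fin poincare_F_pos[of s] by (auto simp: P_def enn2real_positive_iff ennreal_enn2real_if less_top)
  have shift: "emeasure (wmeas s) ((\<lambda>v. k \<otimes> a \<otimes> v) ` F) \<ge> ennreal c * poincare F s" if "k \<in> K" for k
  proof -
    have k: "k \<in> carrier G" "gnorm k < R 0"
      using K_norm[OF that] by auto
    have "ennreal c * poincare F s = (\<integral>\<^sup>+v. ennreal c * ennreal (exp (- s * gnorm v)) \<partial>count_space F)"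
      unfolding poincare_F emeasure_wmeas by (rule nn_integral_cmult[symmetric]) auto
    also have "\<dots> \<le> (\<integral>\<^sup>+v. ennreal (exp (- s * gnorm (k \<otimes> a \<otimes> v))) \<partial>count_space F)"
    proof (intro nn_integral_mono)
      fix v assume "v \<in> space (count_space F)"
      then have v: "v \<in> carrier G"
        using F_carrier by auto
      have "gnorm (k \<otimes> a \<otimes> v) \<le> R 0 + gnorm a + gnorm v"
        using gnorm_mult_le[of "k \<otimes> a" v] gnorm_mult_le[of k a] k v by auto
      then have "s * gnorm (k \<otimes> a \<otimes> v) \<le> s * (R 0 + gnorm a + gnorm v)"
        using s by (rule mult_left_mono)
      then have "c * exp (- s * gnorm v) \<le> exp (- s * gnorm (k \<otimes> a \<otimes> v))"
        by (simp add: c_def exp_add[symmetric] algebra_simps)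
      then show "ennreal c * ennreal (exp (- s * gnorm v)) \<le> ennreal (exp (- s * gnorm (k \<otimes> a \<otimes> v)))"
        by (simp add: ennreal_mult'[symmetric] c_def ennreal_leI)
    qed
    also have "\<dots> = emeasure (wmeas s) ((\<lambda>v. k \<otimes> a \<otimes> v) ` F)"
      using k by (intro emeasure_wmeas_image[symmetric] inj_on_left_mult) auto
    finally show ?thesis .
  qed
  have "ennreal c * poincare F s + ennreal c * poincare F s \<le>
      emeasure (wmeas s) ((\<lambda>v. g \<otimes> a \<otimes> v) ` F) + emeasure (wmeas s) ((\<lambda>v. h \<otimes> a \<otimes> v) ` F)"
    by (intro add_mono shift gh)
  also have "\<dots> = emeasure (wmeas s) ((\<lambda>v. g \<otimes> a \<otimes> v) ` F \<union> (\<lambda>v. h \<otimes> a \<otimes> v) ` F)"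
    using K_words_disjoint[OF gh] by (intro plus_emeasure) auto
  also have "\<dots> \<le> poincare F s"
    unfolding poincare_F using gh gens_F F_mult by (intro emeasure_mono) (auto simp: gens_def)
  finally have "ennreal c * ennreal P + ennreal c * ennreal P \<le> ennreal P"
    by (simp only: P)
  moreover have "ennreal (c * P + c * P) = ennreal c * ennreal P + ennreal c * ennreal P"
  proof -
    have "0 \<le> c" "0 \<le> P"
      using P(2) by (simp_all add: c_def)
    then show ?thesis
      by (simp only: ennreal_plus ennreal_mult mult_nonneg_nonneg)
  qed
  ultimately have "ennreal (c * P + c * P) \<le> ennreal P"
    by (simp only:)
  then have "c * P + c * P \<le> P"
    using P(2) by (simp add: ennreal_le_iff)
  then have "2 * c \<le> 1"
    using P(2) by (simp add: field_simps)
  then have "exp (s * (R 0 + gnorm a)) \<ge> 2"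
  proof -
    have "2 = exp (s * (R 0 + gnorm a)) * (2 * c)"
      by (simp add: c_def exp_add[symmetric])
    also have "\<dots> \<le> exp (s * (R 0 + gnorm a)) * 1"
      using \<open>2 * c \<le> 1\<close> by (intro mult_left_mono) auto
    finally show ?thesis
      by simp
  qed
  then have "ln 2 \<le> s * (R 0 + gnorm a)"
    by (metis exp_le_cancel_iff exp_ln zero_less_numeral)
  then show ?thesis
    using R0_pos gnorm_a_large by (simp add: growth_bound_def field_simps)
qed

text \<open>Convergence at a negative s would imply convergence at 0, which the bound for
  nonnegative exponents rules out.\<close>

lemma growth_bound_le:
  assumes "poincare F s < \<infinity>"
  shows "growth_bound \<le> s"
proof (cases "s \<ge> 0")
  case False
  then have "poincare F 0 \<le> poincare F s"
    unfolding poincare_F using F_carrier by (intro emeasure_wmeas_antimono) auto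
  then have "growth_bound \<le> 0"
    using assms by (intro growth_bound_le_if_nonneg) auto
  then show ?thesis
    using growth_bound_pos by simp
qed (use assms growth_bound_le_if_nonneg in auto)

text \<open>A real infimum is informative only for a nonempty set, whence the exponent taken from
  the growth of G. Some exponent of convergence then lies below s, and the series is antitone in
  s.\<close>

lemma poincare_F_finite:
  assumes "s > crit_exp F"
  shows "poincare F s < \<infinity>"
proof -
  let ?c = "(1 + 0.001 * \<epsilon>) * crit_exp (carrier G)"
  have "poincare F (?c + 1) \<le> emeasure (wmeas (?c + 1)) (carrier G)"
    unfolding poincare_F using F_carrier by (intro emeasure_mono) auto
  also have "\<dots> < \<infinity>"
    using r0_growth r0_nonneg by (intro emeasure_wmeas_finite_of_exponential_growth) auto
  finally have "{s. poincare F s < \<infinity>} \<noteq> {}"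
    by blast
  then obtain t where t: "poincare F t < \<infinity>" "t < s"
    using assms cInf_lessD[of "{s. poincare F s < \<infinity>}" s] by (auto simp: crit_exp_def)
  have "poincare F s \<le> poincare F t"
    unfolding poincare_F using F_carrier t by (intro emeasure_wmeas_antimono) auto
  then show ?thesis
    using t(1) by simp
qed

end

section \<open>Words with a late generator\<close>

context F_construction
begin

text \<open>The possible left contexts of a letter: the empty word, or a short word of F together
  with the connecting a. Discreteness leaves finitely many for each m.\<close>

definition bases :: "real \<Rightarrow> 'g set" where
  "bases m = insert \<one> ((\<lambda>p. p \<otimes> a) ` {p \<in> F. gnorm p < m})"

definition late :: "real \<Rightarrow> nat \<Rightarrow> 'g set" where
  "late m N = {w \<in> F. \<exists>u\<in>bases m. \<exists>k\<ge>N. w = u \<otimes> \<phi> k \<or> (\<exists>v\<in>F. w = u \<otimes> \<phi> k \<otimes> a \<otimes> v)}"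

lemma finite_bases: "finite (bases m)"
proof -
  have "{p \<in> F. gnorm p < m} \<subseteq> gball m"
    using F_carrier by (auto simp: gball_def)
  then show ?thesis
    unfolding bases_def using finite_gball finite_subset by blast
qed

lemma bases_carrier: "u \<in> bases m \<Longrightarrow> u \<in> carrier G"
  using F_carrier by (auto simp: bases_def)

lemma bases_norm:
  assumes "u \<in> bases m" "m \<ge> 0"
  shows "gnorm u \<le> m + gnorm a"
proof (cases "u = \<one>")
  case True
  then show ?thesis
    using assms gnorm_a_large by (simp add: gnorm_one)
next
  case False
  then obtain p where "p \<in> F" "gnorm p < m" "u = p \<otimes> a"
    using assms by (auto simp: bases_def)
  then show ?thesis
    using gnorm_mult_le[of p a] F_carrier by auto
qed

lemma bases_mult: "u \<in> bases m \<Longrightarrow> g \<in> F \<Longrightarrow> u \<otimes> g \<in> F"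
  using F_carrier F_mult by (auto simp: bases_def)

lemma \<phi>_F: "1 \<le> k \<Longrightarrow> \<phi> k \<in> F"
  using gens_F by (auto simp: gens_def)

text \<open>For fixed u and k, left multiplication by u \<phi>_k a is injective on F and
  near-additivity bounds the weight of the image; then the finitely many u and the geometric series
  in k are summed. The constant is uniform because s lies between \<open>growth_bound\<close> and S:
  the lower end gives the decay in k, the upper end bounds the cost of all errors of fixed
  length.\<close>

lemma late_mass_le:
  assumes "m \<ge> 0"
  obtains c where "c \<ge> 0"
    "\<And>(N::nat) s. 1 \<le> N \<Longrightarrow> s \<le> S \<Longrightarrow> poincare F s < \<infinity> \<Longrightarrow>
      emeasure (wmeas s) (late m N) \<le> ennreal (c * exp (- growth_bound) ^ N) * poincare F s"
proof -
  define e where "e = exp (- growth_bound)"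
  have e: "0 < e" "e < 1"
    using growth_bound_pos by (auto simp: e_def)
  obtain g where g: "g \<in> F"
    using F_nonempty by auto
  define S' where "S' = max S 0"
  define D where "D = m + gnorm a"
  \<comment> \<open>\<open>B1\<close> is for words ending in \<phi>_k, whose weight is compared with
    that of the fixed g to become a multiple of the series; \<open>B2\<close> is for words that
    continue. \<open>D\<close> bounds the norm of u.\<close>
  define B1 where "B1 = exp (S' * (D + gnorm g))"
  define B2 where "B2 = exp (S' * (D + gnorm a + 2 * gap))"
  define T where "T u k = insert (u \<otimes> \<phi> k) ((\<lambda>v. u \<otimes> \<phi> k \<otimes> a \<otimes> v) ` F)" for u k
  have mass_T: "emeasure (wmeas s) (T u k) \<le> ennreal ((B1 + B2) * e ^ k) * poincare F s"
    if u: "u \<in> bases m" and k: "1 \<le> k" and s: "s \<le> S" "poincare F s < \<infinity>" for u k s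
  proof -
    define p where "p = u \<otimes> \<phi> k"
    have p: "p \<in> F" "p \<in> carrier G" "property_A a p"
      using bases_mult[OF u \<phi>_F[OF k]] F_property_A by (auto simp: p_def)
    have sb: "growth_bound \<le> s" "s \<le> S'" "0 \<le> s"
      using growth_bound_le[OF s(2)] s(1) growth_bound_pos by (auto simp: S'_def)
    have "gnorm p \<ge> real k - D"
      using gnorm_mult_ge_left[of u "\<phi> k"] bases_carrier[OF u] bases_norm[OF u assms] gnorm_\<phi>_ge[OF k]
        F_carrier \<phi>_F[OF k] by (auto simp: p_def D_def)
    then have "s * (real k - D) \<le> s * gnorm p"
      using sb by (intro mult_left_mono)
    moreover have "growth_bound * real k \<le> s * real k"
      using sb by (intro mult_right_mono) auto
    moreover have "D \<ge> 0"
      using assms gnorm_a_large by (simp add: D_def)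
    then have "s * D \<le> S' * D"
      using sb by (intro mult_right_mono)
    ultimately have sp: "- s * gnorm p \<le> S' * D - growth_bound * real k"
      by (simp add: algebra_simps)
    have ek: "e ^ k = exp (- growth_bound * real k)"
      by (simp add: e_def exp_of_nat_mult[symmetric] mult.commute)
    have "emeasure (wmeas s) {p} \<le> ennreal (B1 * e ^ k) * poincare F s"
    proof -
      have "s * gnorm g \<le> S' * gnorm g"
        using sb g F_carrier by (intro mult_right_mono gnorm_nonneg) auto
      then have "exp (- s * gnorm p) \<le> B1 * e ^ k * exp (- s * gnorm g)"
        using sp unfolding B1_def ek by (simp add: exp_add[symmetric] algebra_simps)
      then have "emeasure (wmeas s) {p} \<le> ennreal (B1 * e ^ k * exp (- s * gnorm g))"
        unfolding emeasure_wmeas_singleton by (rule ennreal_leI)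
      also have "\<dots> = ennreal (B1 * e ^ k) * ennreal (exp (- s * gnorm g))"
        using e by (intro ennreal_mult) (auto simp: B1_def)
      also have "\<dots> \<le> ennreal (B1 * e ^ k) * poincare F s"
        using g by (intro mult_left_mono poincare_F_ge) auto
      finally show ?thesis .
    qed
    moreover have "emeasure (wmeas s) ((\<lambda>v. p \<otimes> a \<otimes> v) ` F) \<le> ennreal (B2 * e ^ k) * poincare F s"
    proof -
      have "emeasure (wmeas s) ((\<lambda>v. p \<otimes> a \<otimes> v) ` F) =
          (\<integral>\<^sup>+v. ennreal (exp (- s * gnorm (p \<otimes> a \<otimes> v))) \<partial>count_space F)"
        using p by (intro emeasure_wmeas_image inj_on_left_mult) auto
      also have "\<dots> \<le> (\<integral>\<^sup>+v. ennreal (B2 * e ^ k) * ennreal (exp (- s * gnorm v)) \<partial>count_space F)"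
      proof (intro nn_integral_mono)
        fix v assume "v \<in> space (count_space F)"
        then have "gnorm p + gnorm v - gnorm a - 2 * gap \<le> gnorm (p \<otimes> a \<otimes> v)"
          using p F_property_A by (intro gnorm_concat_ge) auto
        then have "s * (gnorm p + gnorm v - gnorm a - 2 * gap) \<le> s * gnorm (p \<otimes> a \<otimes> v)"
          using sb by (intro mult_left_mono)
        moreover have "s * (gnorm a + 2 * gap) \<le> S' * (gnorm a + 2 * gap)"
          using sb gnorm_a_large gap_bounds by (intro mult_right_mono) auto
        ultimately have "exp (- s * gnorm (p \<otimes> a \<otimes> v)) \<le> B2 * e ^ k * exp (- s * gnorm v)"
          using sp unfolding B2_def ek by (simp add: exp_add[symmetric] algebra_simps)
        then have "ennreal (exp (- s * gnorm (p \<otimes> a \<otimes> v))) \<le> ennreal (B2 * e ^ k * exp (- s * gnorm v))"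
          by (rule ennreal_leI)
        also have "\<dots> = ennreal (B2 * e ^ k) * ennreal (exp (- s * gnorm v))"
          using e by (intro ennreal_mult) (auto simp: B2_def)
        finally show "ennreal (exp (- s * gnorm (p \<otimes> a \<otimes> v))) \<le>
            ennreal (B2 * e ^ k) * ennreal (exp (- s * gnorm v))" .
      qed
      also have "\<dots> = ennreal (B2 * e ^ k) * poincare F s"
        unfolding poincare_F emeasure_wmeas by (rule nn_integral_cmult) auto
      finally show ?thesis .
    qed
    moreover have "emeasure (wmeas s) (T u k) \<le>
        emeasure (wmeas s) {p} + emeasure (wmeas s) ((\<lambda>v. p \<otimes> a \<otimes> v) ` F)"
      unfolding T_def p_def using emeasure_subadditive[of "{u \<otimes> \<phi> k}" "wmeas s"] by simp
    ultimately have "emeasure (wmeas s) (T u k) \<le>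
        ennreal (B1 * e ^ k) * poincare F s + ennreal (B2 * e ^ k) * poincare F s"
      by (meson add_mono order_trans)
    also have "\<dots> = (ennreal (B1 * e ^ k) + ennreal (B2 * e ^ k)) * poincare F s"
      by (simp add: distrib_right)
    also have "ennreal (B1 * e ^ k) + ennreal (B2 * e ^ k) = ennreal ((B1 + B2) * e ^ k)"
      using e by (simp add: distrib_right ennreal_plus B1_def B2_def)
    finally show ?thesis .
  qed
  define c where "c = real (card (bases m)) * ((B1 + B2) * (1 / (1 - e)))"
  have nonneg: "B1 \<ge> 0" "B2 \<ge> 0" "1 / (1 - e) \<ge> 0"
    using e by (auto simp: B1_def B2_def)
  show thesis
  proof
    show "c \<ge> 0"
      using nonneg by (simp add: c_def)
    fix N :: nat and s assume N: "1 \<le> N" and s: "s \<le> S" "poincare F s < \<infinity>"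
    have "emeasure (wmeas s) (late m N) \<le> emeasure (wmeas s) (\<Union>u\<in>bases m. \<Union>i. T u (N + i))"
    proof (intro emeasure_mono subsetI)
      fix w assume "w \<in> late m N"
      then obtain u k where uk: "u \<in> bases m" "k \<ge> N" "w \<in> T u k"
        by (auto simp: late_def T_def)
      then have "w \<in> T u (N + (k - N))"
        by simp
      then show "w \<in> (\<Union>u\<in>bases m. \<Union>i. T u (N + i))"
        using uk(1) by blast
    qed simp
    also have "\<dots> \<le> (\<Sum>u\<in>bases m. emeasure (wmeas s) (\<Union>i. T u (N + i)))"
      by (intro emeasure_subadditive_finite finite_bases) auto
    also have "\<dots> \<le> (\<Sum>u\<in>bases m. ennreal ((B1 + B2) * (1 / (1 - e)) * e ^ N) * poincare F s)"
    proof (intro sum_mono)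
      fix u assume u: "u \<in> bases m"
      have "emeasure (wmeas s) (\<Union>i. T u (N + i)) \<le> (\<Sum>i. emeasure (wmeas s) (T u (N + i)))"
        by (intro emeasure_subadditive_countably) auto
      also have "\<dots> \<le> (\<Sum>i. ennreal ((B1 + B2) * e ^ (N + i)) * poincare F s)"
        using N u s by (intro suminf_le mass_T) auto
      also have "\<dots> = (\<Sum>i. ennreal ((B1 + B2) * e ^ (N + i))) * poincare F s"
        by simp
      also have "(\<Sum>i. ennreal ((B1 + B2) * e ^ (N + i))) = (\<Sum>i. ennreal ((B1 + B2) * e ^ N * e ^ i))"
        by (simp add: power_add mult.assoc)
      also have "\<dots> = ennreal ((B1 + B2) * e ^ N * (1 / (1 - e)))"
        using e nonneg by (intro suminf_ennreal_eq sums_mult geometric_sums) auto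
      finally show "emeasure (wmeas s) (\<Union>i. T u (N + i)) \<le>
          ennreal ((B1 + B2) * (1 / (1 - e)) * e ^ N) * poincare F s"
        by (simp add: ac_simps)
    qed
    also have "\<dots> = ennreal (real (card (bases m))) * (ennreal ((B1 + B2) * (1 / (1 - e)) * e ^ N) * poincare F s)"
      by (simp add: ennreal_of_nat_eq_real_of_nat)
    also have "\<dots> = ennreal (real (card (bases m)) * ((B1 + B2) * (1 / (1 - e)) * e ^ N)) * poincare F s"
    proof -
      have "0 \<le> (B1 + B2) * (1 / (1 - e)) * e ^ N"
        using nonneg e by (intro mult_nonneg_nonneg) auto
      then show ?thesis
        by (simp only: ennreal_mult of_nat_0_le_iff mult.assoc)
    qed
    also have "real (card (bases m)) * ((B1 + B2) * (1 / (1 - e)) * e ^ N) = c * exp (- growth_bound) ^ N"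
      by (simp add: c_def e_def)
    finally show "emeasure (wmeas s) (late m N) \<le> ennreal (c * exp (- growth_bound) ^ N) * poincare F s" .
  qed
qed

text \<open>If no prefix of a word has length between \<open>m\<close> and \<open>T\<close>, the generator which crosses this gap is
  so long that it must be some \<open>\<phi>\<^sub>k\<close> with \<open>k\<close> large.\<close>

lemma gap_imp_late:
  assumes m: "m \<ge> 0" and T: "T \<ge> m + gnorm a + R 0 + (\<Sum>k\<in>{1..<N}. gnorm (\<phi> k))"
    and w: "w \<in> F" "gnorm w > T"
    and prefix: "\<And>r v. r \<in> F \<Longrightarrow> v \<in> F \<Longrightarrow> w = r \<otimes> a \<otimes> v \<Longrightarrow> gnorm r < m \<or> gnorm r > T"
  shows "w \<in> late m N"
proof -
  \<comment> \<open>T exceeds the largest norm of an element of \<open>bases m\<close> by R_0, which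
    bounds the norms in K, plus a sum which bounds each \<phi>_k with k < N.\<close>
  have long: "\<exists>k\<ge>N. g = \<phi> k" if u: "u \<in> bases m" and g: "g \<in> gens" and "gnorm (u \<otimes> g) > T" for u g
  proof -
    have gG: "g \<in> carrier G"
      using g gens_carrier by auto
    have phi_nonneg: "gnorm (\<phi> k) \<ge> 0" if "k \<in> {1..<N}" for k
      using that \<phi>_F[of k] F_carrier by (intro gnorm_nonneg) auto
    have "gnorm (u \<otimes> g) \<le> gnorm u + gnorm g"
      using bases_carrier[OF u] gG by (rule gnorm_mult_le)
    then have large: "gnorm g > R 0 + (\<Sum>k\<in>{1..<N}. gnorm (\<phi> k))"
      using bases_norm[OF u m] \<open>gnorm (u \<otimes> g) > T\<close> T by linarith
    moreover have "(\<Sum>k\<in>{1..<N}. gnorm (\<phi> k)) \<ge> 0"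
      using phi_nonneg by (rule sum_nonneg)
    ultimately have "g \<notin> K"
      using K_norm[of g] by auto
    then obtain k where k: "k \<ge> 1" "g = \<phi> k"
      using g by (auto simp: gens_def)
    have "k \<ge> N"
    proof (rule ccontr)
      assume "\<not> k \<ge> N"
      then have "gnorm (\<phi> k) \<le> (\<Sum>k\<in>{1..<N}. gnorm (\<phi> k))"
        using k phi_nonneg by (intro member_le_sum) auto
      then show False
        using large k R0_pos by simp
    qed
    then show ?thesis
      using k by blast
  qed
  \<comment> \<open>The word is read from the left, with u already read and x remaining. A prefix
    shorter than m is moved into u; otherwise it is longer than T and its last letter is late. The
    word itself is longer than T, so such a letter occurs at the latest at its end.\<close>
  have "w \<in> late m N" if "x \<in> a_words a gens" "u \<in> bases m" "w = u \<otimes> x" for x u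
    using that
  proof (induction arbitrary: u rule: a_words.induct)
    case (single g)
    then show ?case
      using long[of u g] w by (auto simp: late_def)
  next
    case (cons g x)
    have x: "x \<in> F" and g: "g \<in> F"
      using cons.hyps gens_F by (auto simp: F_eq_a_words)
    have G: "x \<in> carrier G" "g \<in> carrier G" "u \<in> carrier G"
      using x g F_carrier bases_carrier[OF cons.prems(1)] by auto
    have w_eq: "w = u \<otimes> g \<otimes> a \<otimes> x"
      using cons.prems(2) G by (simp add: G.m_assoc)
    have ug: "u \<otimes> g \<in> F"
      using bases_mult[OF cons.prems(1) g] .
    show ?case
    proof (cases "gnorm (u \<otimes> g) < m")
      case True
      then have "u \<otimes> g \<otimes> a \<in> bases m"
        using ug by (auto simp: bases_def)
      then show ?thesis
        using cons.IH w_eq by blast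
    next
      case False
      then obtain k where "k \<ge> N" "g = \<phi> k"
        using prefix[OF ug x w_eq] long[OF cons.prems(1) cons.hyps(1)] by blast
      then show ?thesis
        using w(1) w_eq x cons.prems(1) by (auto simp: late_def)
    qed
  qed
  moreover have "\<one> \<in> bases m" "w = \<one> \<otimes> w"
    using w F_carrier by (auto simp: bases_def)
  ultimately show ?thesis
    using w(1) unfolding F_eq_a_words by blast
qed

text \<open>If the orbit point of w is close to \<xi>, the geodesic to it and the ray stay together
  up to time T. A prefix p with norm in [m, T] is close to that geodesic, hence within 2
  \<open>gap\<close> + 10 < 3 C of the ray at time \<open>gnorm p\<close>, contrary to
  avoidance.\<close>

lemma avoiding_ray_imp_late:
  assumes m: "m \<ge> 0" and \<xi>: "\<xi> \<in> avoiding_rays x0 (orb F) m (3 * C)"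
  shows "\<exists>U. open U \<and> \<xi> \<in> U \<and> (\<forall>w\<in>F. act w x0 \<in> U \<longrightarrow> w \<in> late m N)"
proof -
  obtain \<gamma> where bd: "\<xi> \<in> hboundary" and ray: "geodesic_ray x0 \<xi> \<gamma>"
    and avoid: "\<And>t p. t \<ge> m \<Longrightarrow> p \<in> F \<Longrightarrow> hdist (\<gamma> t) (act p x0) \<ge> 3 * C"
    using \<xi> by (auto simp: avoiding_rays_def orb_def)
  have \<gamma>: "\<gamma> 0 = x0" "\<And>t. t \<ge> 0 \<Longrightarrow> \<gamma> t \<in> hspace"
    "\<And>s t. s \<ge> 0 \<Longrightarrow> t \<ge> 0 \<Longrightarrow> hdist (\<gamma> s) (\<gamma> t) = \<bar>s - t\<bar>"
    using ray by (auto simp: geodesic_ray_def geodesic_on_def)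
  have \<gamma>0: "hdist (\<gamma> t) x0 = t" if "t \<ge> 0" for t
    using \<gamma>(1) \<gamma>(3)[of t 0] that by simp
  define T where "T = m + gnorm a + R 0 + (\<Sum>k\<in>{1..<N}. gnorm (\<phi> k))"
  \<comment> \<open>The added 1 makes w strictly longer than T, since its norm bounds the
    product.\<close>
  obtain r where r: "r > 0" "\<And>p q. p \<in> hspace \<Longrightarrow> q \<in> hspace \<Longrightarrow> dist \<xi> p < r \<Longrightarrow> dist \<xi> q < r \<Longrightarrow>
      gromov_product p q x0 \<ge> T + 1"
    using gromov_product_large_near_boundary[OF bd basepoint] by blast
  show ?thesis
  proof (intro exI[of _ "ball \<xi> r"] conjI ballI impI)
    show "open (ball \<xi> r)" "\<xi> \<in> ball \<xi> r"
      using r by (auto simp: mem_ball)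
    fix w assume w: "w \<in> F" and near: "act w x0 \<in> ball \<xi> r"
    have wG: "w \<in> carrier G" "act w x0 \<in> hspace"
      using w F_carrier by auto
    have "\<forall>\<^sub>F t in at_top. dist (\<gamma> t) \<xi> < r"
      using ray r(1) by (auto simp: geodesic_ray_def intro: tendstoD)
    then obtain t0 where t0: "\<And>t. t \<ge> t0 \<Longrightarrow> dist (\<gamma> t) \<xi> < r"
      by (auto simp: eventually_at_top_linorder)
    define t where "t = max t0 (max T 0)"
    have t: "dist (\<gamma> t) \<xi> < r" "t \<ge> T" "t \<ge> 0"
      by (auto simp: t_def intro: t0)
    have gp_t: "gromov_product (act w x0) (\<gamma> t) x0 \<ge> T + 1"
      using near t \<gamma>(2)[of t] wG by (intro r(2)) (auto simp: mem_ball dist_commute)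
    have "gromov_product (act w x0) (\<gamma> t) x0 \<le> gnorm w"
      using gromov_product_base_change[of "act w x0" "\<gamma> t" x0]
        gromov_product_nonneg[of x0 "\<gamma> t" "act w x0"] basepoint wG \<gamma>(2)[of t] t
      by (simp add: gnorm_def hdist_commute)
    then have "gnorm w > T"
      using gp_t by simp
    show "w \<in> late m N"
    proof (rule gap_imp_late[OF m _ w \<open>gnorm w > T\<close>])
      fix p v assume p: "p \<in> F" "v \<in> F" "w = p \<otimes> a \<otimes> v"
      show "gnorm p < m \<or> gnorm p > T"
      proof (rule ccontr)
        assume "\<not> (gnorm p < m \<or> gnorm p > T)"
        then have l: "m \<le> gnorm p" "gnorm p \<le> T" by auto
        have pG: "p \<in> carrier G" "act p x0 \<in> hspace"
          using p F_carrier by auto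
        have "gromov_product x0 (act w x0) (act p x0) \<le> gap"
          using gromov_product_concat[of p v] p F_property_A by auto
        then have 1: "gromov_product (act p x0) (act w x0) x0 \<ge> gnorm p - gap"
          using gromov_product_base_change[of "act p x0" "act w x0" x0]
          by (simp add: gnorm_def hdist_commute)
        have in_h: "\<gamma> t \<in> hspace" "\<gamma> (gnorm p) \<in> hspace"
          using \<gamma>(2) t l m by auto
        have 2: "gromov_product (act p x0) (\<gamma> t) x0 \<ge>
            min (gromov_product (act p x0) (act w x0) x0) (gromov_product (act w x0) (\<gamma> t) x0) - 5 / 2"
          using gromov_product_hyperbolic[OF pG(2) wG(2) in_h(1) basepoint]
          by (simp add: gromov_product_commute)
        have 3: "gromov_product (\<gamma> t) (\<gamma> (gnorm p)) x0 = gnorm p"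
          using \<gamma>0[of t] \<gamma>0[of "gnorm p"] \<gamma>(3)[of t "gnorm p"] t l m
          by (simp add: gromov_product_def hdist_commute)
        have "gromov_product (act p x0) (\<gamma> (gnorm p)) x0 \<ge>
            min (gromov_product (act p x0) (\<gamma> t) x0) (gromov_product (\<gamma> t) (\<gamma> (gnorm p)) x0) - 5 / 2"
          using gromov_product_hyperbolic[OF pG(2) in_h(1) in_h(2) basepoint]
          by (simp add: gromov_product_commute)
        then have "gromov_product (act p x0) (\<gamma> (gnorm p)) x0 \<ge> gnorm p - gap - 5"
          using 1 2 3 gp_t l gap_bounds by linarith
        then have "hdist (act p x0) (\<gamma> (gnorm p)) \<le> 2 * gap + 10"
          using \<gamma>0[of "gnorm p"] l m by (simp add: gromov_product_def gnorm_def hdist_commute)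
        then show False
          using avoid[OF l(1) p(1)] gap_bounds C_large by (simp add: hdist_commute)
      qed
    qed (simp add: T_def)
  qed
qed

section \<open>From late words to null sets of the limit measure\<close>

lemma orb_F_hspace: "orb F \<subseteq> hspace"
  using F_carrier by (auto simp: orb_def)

lemma closed_in_sets_\<mu>:
  assumes "sets \<mu> = sets (restrict_space borel orbit_with_boundary)" "closed D" "D \<subseteq> hboundary"
  shows "D \<in> sets \<mu>"
proof -
  have "D = orbit_with_boundary \<inter> D"
    using assms(3) by (auto simp: orbit_with_boundary_def)
  then show ?thesis
    unfolding assms(1) sets_restrict_space using assms(2) by (metis borel_closed imageI)
qed

lemma emeasure_ps_approx_total:
  assumes "poincare F s < \<infinity>"
  shows "emeasure (ps_approx F s) orbit_with_boundary = 1"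
proof -
  have "orbit_with_boundary \<in> sets (restrict_space borel orbit_with_boundary)"
    by (metis sets.top space_restrict_space space_borel Int_UNIV_right)
  then have "emeasure (ps_approx F s) orbit_with_boundary =
      emeasure (wmeas s) {g \<in> F. act g x0 \<in> orbit_with_boundary} / poincare F s"
    by (rule emeasure_ps_approx[OF F_carrier])
  also have "{g \<in> F. act g x0 \<in> orbit_with_boundary} = F"
    using F_carrier by (auto simp: orbit_with_boundary_def orb_def)
  also have "emeasure (wmeas s) F / poincare F s = 1"
    unfolding poincare_F[symmetric] using assms poincare_F_pos[of s] by (intro ennreal_divide_self) auto
  finally show ?thesis .
qed

lemma avoiding_rays_null:
  assumes ps: "patterson_sullivan F \<mu>" and m: "m \<ge> 0"
  shows "avoiding_rays x0 (orb F) m (3 * C) \<in> null_sets \<mu>"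
proof -
  obtain s where s: "decseq s" "\<And>n. s n > crit_exp F"
    and lim: "weak_limit_on orbit_with_boundary (\<lambda>n. ps_approx F (s n)) \<mu>"
    using ps by (auto simp: patterson_sullivan_def)
  have fin: "poincare F (s n) < \<infinity>" for n
    by (rule poincare_F_finite[OF s(2)])
  have s_le: "s n \<le> s 0" for n
    using s(1) by (simp add: decseqD)
  let ?A = "avoiding_rays x0 (orb F) m (3 * C)"
  have sets_\<mu>: "sets \<mu> = sets (restrict_space borel orbit_with_boundary)"
    using lim by (simp add: weak_limit_on_def)
  have A_sets: "?A \<in> sets \<mu>"
    using closed_avoiding_rays[OF basepoint orb_F_hspace m] by (intro closed_in_sets_\<mu>[OF sets_\<mu>])
      (auto simp: avoiding_rays_def)
  obtain c where c: "c \<ge> 0" "\<And>(N::nat) t. 1 \<le> N \<Longrightarrow> t \<le> s 0 \<Longrightarrow> poincare F t < \<infinity> \<Longrightarrow>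
      emeasure (wmeas t) (late m N) \<le> ennreal (c * exp (- growth_bound) ^ N) * poincare F t"
    using late_mass_le[OF m] by blast
  have le: "emeasure \<mu> ?A \<le> ennreal (c * exp (- growth_bound) ^ N)" if N: "1 \<le> N" for N :: nat
  proof -
    \<comment> \<open>The condition on V passes to arbitrary unions, so U is itself such a set, and
      one estimate serves all end points at once.\<close>
    define U where "U = \<Union>{V. open V \<and> (\<forall>w\<in>F. act w x0 \<in> V \<longrightarrow> w \<in> late m N)}"
    have "open U"
      unfolding U_def by (intro open_Union) auto
    have A_U: "?A \<subseteq> U \<inter> orbit_with_boundary"
    proof
      fix \<xi> assume \<xi>: "\<xi> \<in> ?A"
      then have "\<xi> \<in> U"
        using avoiding_ray_imp_late[OF m, of \<xi> N] unfolding U_def by blast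
      moreover have "\<xi> \<in> hboundary"
        using \<xi> unfolding avoiding_rays_def by blast
      ultimately show "\<xi> \<in> U \<inter> orbit_with_boundary"
        by (simp add: orbit_with_boundary_def)
    qed
    have U_sets: "U \<inter> orbit_with_boundary \<in> sets (restrict_space borel orbit_with_boundary)"
      unfolding sets_restrict_space using \<open>open U\<close> by auto
    have "emeasure \<mu> ?A \<le> emeasure \<mu> (U \<inter> orbit_with_boundary)"
      using A_U U_sets by (intro emeasure_mono) (auto simp: sets_\<mu>)
    also have "\<dots> \<le> ennreal (c * exp (- growth_bound) ^ N)"
    proof (rule weak_limit_on_open_le[OF lim \<open>open U\<close>])
      fix n
      show "sets (ps_approx F (s n)) = sets (restrict_space borel orbit_with_boundary)"
        by (simp add: ps_approx_def)
      show "emeasure (ps_approx F (s n)) orbit_with_boundary = 1"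
        by (rule emeasure_ps_approx_total[OF fin])
      have "emeasure (ps_approx F (s n)) (U \<inter> orbit_with_boundary) =
          emeasure (wmeas (s n)) {g \<in> F. act g x0 \<in> U \<inter> orbit_with_boundary} / poincare F (s n)"
        by (rule emeasure_ps_approx[OF F_carrier U_sets])
      also have "\<dots> \<le> emeasure (wmeas (s n)) (late m N) / poincare F (s n)"
        by (intro divide_right_mono_ennreal emeasure_mono) (auto simp: U_def)
      also have "\<dots> \<le> ennreal (c * exp (- growth_bound) ^ N) * poincare F (s n) / poincare F (s n)"
        using N s_le fin by (intro divide_right_mono_ennreal c(2))
      also have "\<dots> = ennreal (c * exp (- growth_bound) ^ N)"
        using fin[of n] poincare_F_pos[of "s n"] by (intro ennreal_mult_divide_eq) auto
      finally show "emeasure (ps_approx F (s n)) (U \<inter> orbit_with_boundary) \<le> ennreal (c * exp (- growth_bound) ^ N)" .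
    qed (use c(1) in simp)
    finally show ?thesis .
  qed
  have "(\<lambda>N. c * exp (- growth_bound) ^ N) \<longlonglongrightarrow> c * 0"
    using growth_bound_pos by (intro tendsto_mult tendsto_const LIMSEQ_realpow_zero) auto
  then have "(\<lambda>N. ennreal (c * exp (- growth_bound) ^ N)) \<longlonglongrightarrow> ennreal 0"
    by (intro tendsto_ennrealI) simp
  then have "emeasure \<mu> ?A \<le> ennreal 0"
    by (rule LIMSEQ_le_const) (use le in blast)
  then show ?thesis
    using A_sets by (intro null_setsI) auto
qed

lemma hsetdist_orbit_bounds:
  assumes "x \<in> hspace"
  shows "q \<le> hsetdist {x} (orb F) \<longleftrightarrow> (\<forall>p\<in>orb F. q \<le> hdist x p)"
proof -
  have "{hdist y p | y p. y \<in> {x} \<and> p \<in> orb F} = hdist x ` orb F"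
    by auto
  moreover have "orb F \<noteq> {}"
    using F_nonempty by (simp add: orb_def)
  moreover have "bdd_below (hdist x ` orb F)"
    using orb_F_hspace assms by (intro bdd_belowI[of _ 0]) (auto intro!: hdist_nonneg)
  ultimately show ?thesis
    unfolding hsetdist_def by (simp add: le_cINF_iff)
qed

text \<open>The strict inequality leaves room for some 1 / (j + 1), and a natural number serves as
  the starting time; both parameters are countable, as the union of null sets requires.\<close>

lemma Liminf_hsetdist_iff:
  assumes "geodesic_ray x0 \<xi> \<gamma>"
  shows "Liminf at_top (\<lambda>t. ereal (hsetdist {\<gamma> t} (orb F))) > ereal r \<longleftrightarrow>
    (\<exists>j m :: nat. \<forall>t\<ge>m. \<forall>p\<in>orb F. r + 1 / real (Suc j) \<le> hdist (\<gamma> t) p)"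
proof -
  have \<gamma>: "\<gamma> t \<in> hspace" if "t \<ge> real m" for t and m :: nat
  proof -
    have "t \<ge> 0"
      using that by (rule order_trans[rotated]) simp
    then show ?thesis
      using assms by (auto simp: geodesic_ray_def geodesic_on_def)
  qed
  show ?thesis
  proof
    assume "Liminf at_top (\<lambda>t. ereal (hsetdist {\<gamma> t} (orb F))) > ereal r"
    then obtain q where q: "r < q" "ereal q < Liminf at_top (\<lambda>t. ereal (hsetdist {\<gamma> t} (orb F)))"
      using ereal_dense2 by (metis less_ereal.simps(1))
    obtain j where j: "inverse (real (Suc j)) < q - r"
      using reals_Archimedean[of "q - r"] q by auto
    have "\<forall>\<^sub>F t in at_top. q < hsetdist {\<gamma> t} (orb F)"
      using less_LiminfD[OF q(2)] by simp
    then obtain M where M: "\<And>t. t \<ge> M \<Longrightarrow> q < hsetdist {\<gamma> t} (orb F)"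
      by (auto simp: eventually_at_top_linorder)
    obtain m :: nat where m: "real m \<ge> M"
      using real_arch_simple by blast
    have "r + 1 / real (Suc j) \<le> hsetdist {\<gamma> t} (orb F)" if "t \<ge> real m" for t
      using M[of t] that m j by (simp add: inverse_eq_divide)
    then show "\<exists>j m :: nat. \<forall>t\<ge>m. \<forall>p\<in>orb F. r + 1 / real (Suc j) \<le> hdist (\<gamma> t) p"
      using hsetdist_orbit_bounds[OF \<gamma>] by blast
  next
    assume "\<exists>j m :: nat. \<forall>t\<ge>m. \<forall>p\<in>orb F. r + 1 / real (Suc j) \<le> hdist (\<gamma> t) p"
    then obtain j m :: nat where "\<forall>t\<ge>real m. \<forall>p\<in>orb F. r + 1 / real (Suc j) \<le> hdist (\<gamma> t) p"
      by blast
    then have "\<forall>t\<ge>real m. r + 1 / real (Suc j) \<le> hsetdist {\<gamma> t} (orb F)"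
      using hsetdist_orbit_bounds[OF \<gamma>] by blast
    then have "ereal (r + 1 / real (Suc j)) \<le> Liminf at_top (\<lambda>t. ereal (hsetdist {\<gamma> t} (orb F)))"
      by (intro Liminf_bounded) (auto simp: eventually_at_top_linorder)
    moreover have "ereal r < ereal (r + 1 / real (Suc j))"
      by simp
    ultimately show "Liminf at_top (\<lambda>t. ereal (hsetdist {\<gamma> t} (orb F))) > ereal r"
      by (rule less_le_trans[rotated])
  qed
qed

lemma nonconical_null:
  assumes ps: "patterson_sullivan F \<mu>"
  shows "{\<xi> \<in> limit_set F. \<exists>\<gamma>. geodesic_ray x0 \<xi> \<gamma> \<and>
      Liminf at_top (\<lambda>t. ereal (hsetdist {\<gamma> t} (orb F))) > ereal (3 * C)} \<in> null_sets \<mu>"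
proof -
  have sets_\<mu>: "sets \<mu> = sets (restrict_space borel orbit_with_boundary)"
    using ps by (auto simp: patterson_sullivan_def weak_limit_on_def)
  define A where "A j m = avoiding_rays x0 (orb F) (real m) (3 * C + 1 / real (Suc j))" for j m
  have "A j m \<in> null_sets \<mu>" for j m
  proof (rule null_sets_subset)
    show "avoiding_rays x0 (orb F) (real m) (3 * C) \<in> null_sets \<mu>"
      by (intro avoiding_rays_null ps) simp
    \<comment> \<open>\<mu> need not be complete, so a subset of a null set must be shown
      measurable; closedness provides this.\<close>
    show "A j m \<in> sets \<mu>"
      unfolding A_def using closed_avoiding_rays[OF basepoint orb_F_hspace]
      by (intro closed_in_sets_\<mu>[OF sets_\<mu>]) (auto simp: avoiding_rays_def)
    have "3 * C \<le> q" if "3 * C + 1 / real (Suc j) \<le> q" for q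
      using that by (rule order_trans[rotated]) simp
    then show "A j m \<subseteq> avoiding_rays x0 (orb F) (real m) (3 * C)"
      unfolding A_def avoiding_rays_def by blast
  qed
  then have "(\<Union>j. \<Union>m. A j m) \<in> null_sets \<mu>"
    by (intro null_sets_UN)
  moreover have "limit_set F \<in> sets \<mu>"
  proof (rule closed_in_sets_\<mu>[OF sets_\<mu>])
    have "limit_set F = hboundary \<inter> {\<xi>. \<xi> islimpt orb F}"
      by (auto simp: limit_set_def)
    then show "closed (limit_set F)"
      using closed_Int[OF closed_sphere closed_limpts] by metis
  qed (auto simp: limit_set_def)
  ultimately have "limit_set F \<inter> (\<Union>j. \<Union>m. A j m) \<in> null_sets \<mu>"
    by (rule null_set_Int1)
  also have "limit_set F \<inter> (\<Union>j. \<Union>m. A j m) =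
      {\<xi> \<in> limit_set F. \<exists>\<gamma>. geodesic_ray x0 \<xi> \<gamma> \<and>
        Liminf at_top (\<lambda>t. ereal (hsetdist {\<gamma> t} (orb F))) > ereal (3 * C)}"
  proof -
    have "\<xi> \<in> (\<Union>j. \<Union>m. A j m) \<longleftrightarrow> (\<exists>\<gamma>. geodesic_ray x0 \<xi> \<gamma> \<and>
        Liminf at_top (\<lambda>t. ereal (hsetdist {\<gamma> t} (orb F))) > ereal (3 * C))" if "\<xi> \<in> limit_set F" for \<xi>
    proof -
      have "\<xi> \<in> hboundary"
        using that by (simp add: limit_set_def)
      then have "\<xi> \<in> (\<Union>j. \<Union>m. A j m) \<longleftrightarrow> (\<exists>\<gamma>. geodesic_ray x0 \<xi> \<gamma> \<and>
          (\<exists>j m :: nat. \<forall>t\<ge>m. \<forall>p\<in>orb F. 3 * C + 1 / real (Suc j) \<le> hdist (\<gamma> t) p))"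
        unfolding A_def avoiding_rays_def by blast
      also have "\<dots> \<longleftrightarrow> (\<exists>\<gamma>. geodesic_ray x0 \<xi> \<gamma> \<and>
          Liminf at_top (\<lambda>t. ereal (hsetdist {\<gamma> t} (orb F))) > ereal (3 * C))"
        by (intro ex_cong1 conj_cong refl Liminf_hsetdist_iff[symmetric])
      finally show ?thesis .
    qed
    then show ?thesis
      by (simp only: set_eq_iff Int_iff mem_Collect_eq cong: conj_cong) simp
  qed
  finally show ?thesis .
qed

end

theorem lemma5p5:
  fixes G :: "('g, 'm) monoid_scheme"
    and act :: "'g \<Rightarrow> 'a::euclidean_space \<Rightarrow> 'a"
    and x0 :: 'a
  assumes "F_construction G act x0 enum a b \<Phi> \<epsilon> r0 R K \<beta> eps \<phi>' \<phi>"
  defines "F \<equiv> hyp_extension.F_total G a K \<phi>"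
    and "C \<equiv> hyp_extension.C act x0 a"
  assumes "hyp_data.patterson_sullivan G act x0 F \<mu>"
  shows "{\<xi> \<in> hyp_data.limit_set act x0 F. \<exists>\<gamma>. geodesic_ray x0 \<xi> \<gamma> \<and>
            Liminf at_top (\<lambda>t. ereal (hsetdist {\<gamma> t} (hyp_data.orb act x0 F))) > ereal (3 * C)}
         \<in> null_sets \<mu>"
proof -
  interpret F_construction G act x0 enum a b \<Phi> \<epsilon> r0 R K \<beta> eps \<phi>' \<phi>
    by (rule assms(1))
  show ?thesis
    using nonconical_null assms(4) unfolding assms(2,3) .
qed

end
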